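(* Let $n$ and $m$ be integers with $1\le m\le n$, and let $H^{+}_{n+1}(x,y)$ and $H^{-}_{m+1}(x,y)$ be real homogeneous polynomials of degrees $n+1$ and $m+1$ respectively. Let $X$ be the planar piecewise Hamiltonian system with switching line $y=0$ given by $X=X_+$ for $y\ge 0$ and $X=X_-$ for $y<0$, where $$X_{\pm}:\quad \frac{dx}{dt}=-\frac{\partial H_{\pm}}{\partial y}(x,y),\qquad \frac{dy}{dt}=\frac{\partial H_{\pm}}{\partial x}(x,y),$$ $$H_{+}(x,y)=\frac{x^2+y^2}{2}+H^{+}_{n+1}(x,y),\qquad H_{-}(x,y)=\frac{x^2+y^2}{2}+H^{-}_{m+1}(x,y).$$ If $n$ is even, then the origin is not an isochronous $\Sigma$-center of $X$.
   Context: The origin is a $\Sigma$-center of $X$ if it has a neighborhood in which it is surrounded by closed orbits, each formed by a trajectory of $X_+$ in the upper half plane and a trajectory of $X_-$ in the lower half plane. Explicitly: for every sufficiently small $p>0$, the trajectory of $X_+$ starting at $(p,0)$ runs through $\{y>0\}$ until it meets the negative $x$-axis at a point $(\varphi_+(p),0)$, the trajectory of $X_-$ in $\{y<0\}$ that ends at $(p,0)$ starts at a point $(\varphi_-(p),0)$ of the negative $x$-axis, and $\varphi_+(p)=\varphi_-(p)$; the closed orbit $\gamma$ through $(p,0)$ is the union of these two arcs. The period $T(\gamma)$ of such a closed orbit is the sum of the times spent along the $X_+$-arc and the $X_-$-arc. A $\Sigma$-center is isochronous if $T(\gamma)$ is constant, i.e. independent of $\gamma$. *)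

theory Defs
  imports "HOL-Analysis.Analysis"
begin

text \<open>A bivariate polynomial is identified with its polynomial function. Having degree \<open>d\<close>
  excludes the zero polynomial.\<close>

definition homogeneous_poly :: "nat \<Rightarrow> (real \<Rightarrow> real \<Rightarrow> real) \<Rightarrow> bool" where
  "homogeneous_poly d P \<longleftrightarrow>
     (\<exists>a :: nat \<Rightarrow> real. (\<exists>i\<le>d. a i \<noteq> 0) \<and> (\<forall>x y. P x y = (\<Sum>i\<le>d. a i * x ^ i * y ^ (d - i))))"

definition hamiltonian_field :: "(real \<Rightarrow> real \<Rightarrow> real) \<Rightarrow> real \<times> real \<Rightarrow> real \<times> real" where
  "hamiltonian_field H = (\<lambda>(x, y). (- deriv (\<lambda>v. H x v) y, deriv (\<lambda>u. H u y) x))"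

definition trajectory_on ::
    "(real \<times> real \<Rightarrow> real \<times> real) \<Rightarrow> real set \<Rightarrow> (real \<Rightarrow> real \<times> real) \<Rightarrow> bool" where
  "trajectory_on X I \<gamma> \<longleftrightarrow> (\<forall>t\<in>I. (\<gamma> has_vector_derivative X (\<gamma> t)) (at t within I))"

text \<open>Some trajectory of \<open>X\<close> goes from \<open>(a, 0)\<close> to \<open>(b, 0)\<close> in time \<open>T > 0\<close>, staying in \<open>S\<close>
  strictly in between.\<close>

definition arc_through ::
    "(real \<times> real \<Rightarrow> real \<times> real) \<Rightarrow> (real \<times> real) set \<Rightarrow> real \<Rightarrow> real \<Rightarrow> real \<Rightarrow> bool" where
  "arc_through X S a b T \<longleftrightarrow> 0 < T \<and>
     (\<exists>\<gamma>. trajectory_on X {0..T} \<gamma> \<and> \<gamma> 0 = (a, 0) \<and> \<gamma> T = (b, 0) \<and> (\<forall>t\<in>{0<..<T}. \<gamma> t \<in> S))"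

text \<open>In the remaining definitions the piecewise system with switching line \<open>y = 0\<close> is given by
  its pair of fields: \<open>Xp\<close> for \<open>y \<ge> 0\<close> and \<open>Xm\<close> for \<open>y < 0\<close>. The point \<open>(q, 0)\<close> is the common
  value of the two half-return maps \<open>\<phi>\<^sub>+\<close> and \<open>\<phi>\<^sub>-\<close> at \<open>p\<close>; for locally Lipschitz fields,
  \<open>q\<close>, both times and hence \<open>T\<close> are determined by \<open>p\<close>.\<close>

definition closed_orbit_period ::
    "(real \<times> real \<Rightarrow> real \<times> real) \<Rightarrow> (real \<times> real \<Rightarrow> real \<times> real) \<Rightarrow> real \<Rightarrow> real \<Rightarrow> bool" where
  "closed_orbit_period Xp Xm p T \<longleftrightarrow>
     (\<exists>q Tp Tm. q < 0 \<and>
        arc_through Xp {(x, y). y > 0} p q Tp \<and>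
        arc_through Xm {(x, y). y < 0} q p Tm \<and>
        T = Tp + Tm)"

definition sigma_center ::
    "(real \<times> real \<Rightarrow> real \<times> real) \<Rightarrow> (real \<times> real \<Rightarrow> real \<times> real) \<Rightarrow> bool" where
  "sigma_center Xp Xm \<longleftrightarrow> (\<forall>\<^sub>F p in at_right 0. \<exists>T. closed_orbit_period Xp Xm p T)"

definition isochronous_sigma_center ::
    "(real \<times> real \<Rightarrow> real \<times> real) \<Rightarrow> (real \<times> real \<Rightarrow> real \<times> real) \<Rightarrow> bool" where
  "isochronous_sigma_center Xp Xm \<longleftrightarrow> sigma_center Xp Xm \<and>
     (\<exists>T0. \<forall>\<^sub>F p in at_right 0. \<forall>T. closed_orbit_period Xp Xm p T \<longrightarrow> T = T0)"

end

theory Submission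
  imports Defs
begin

text \<open>In polar coordinates \<open>H\<^sub>+ = r\<^sup>2/2 + r\<^sup>n\<^sup>+\<^sup>1 h(\<theta>)\<close> gives \<open>\<theta>' = 1 + (n + 1) w\<close> with
  \<open>w = r\<^sup>n\<^sup>-\<^sup>1 h\<close>, and conservation of \<open>2 H\<^sub>+ = \<rho>\<^sup>2\<close> reads \<open>\<rho>\<^sup>2 = r\<^sup>2 (1 + 2 w)\<close>. Expanding \<open>1/\<theta>'\<close> in
  \<open>\<epsilon> = \<rho>\<^sup>n\<^sup>-\<^sup>1\<close>, the upper arc takes the time \<open>\<pi> - (n + 1) J\<^sub>1 \<epsilon> + 2 n (n + 1) J\<^sub>2 \<epsilon>\<^sup>2 + o(\<epsilon>\<^sup>2)\<close>,
  where \<open>J\<^sub>1\<close> and \<open>J\<^sub>2 > 0\<close> are the integrals of \<open>h\<close> and \<open>h\<^sup>2\<close> over \<open>[0, \<pi>]\<close>. Rotating by \<open>\<pi>\<close> gives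
  the same for the lower arc, with \<open>m\<close> in place of \<open>n\<close>; it takes constant time if \<open>m = 1\<close>.
  If \<open>m = n\<close> is even, both half-return maps agree only if \<open>H\<^sub>+ = H\<^sub>-\<close> on the \<open>x\<close>-axis, so both
  expansions are in the same \<open>\<epsilon>\<close> and their positive second order terms add up. If \<open>1 < m < n\<close>, the
  second order term of the lower arc has order \<open>2 (m - 1)\<close>. It cannot be compensated by the
  first order term of the upper arc, whose order \<open>n - 1\<close> is odd, and all other terms vanish or are
  of higher order.\<close>

section \<open>Homogeneous polynomials\<close>

lemma homogeneous_poly_scale:
  assumes "homogeneous_poly d P"
  shows "P (r * x) (r * y) = r ^ d * P x y"
proof -
  obtain a where a: "\<And>x y. P x y = (\<Sum>i\<le>d. a i * x ^ i * y ^ (d - i))"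
    using assms unfolding homogeneous_poly_def by auto
  have "a i * (r * x) ^ i * (r * y) ^ (d - i) = r ^ d * (a i * x ^ i * y ^ (d - i))" if "i \<le> d" for i
  proof -
    have "r ^ d = r ^ i * r ^ (d - i)"
      using that by (simp flip: power_add)
    then show ?thesis by (simp add: power_mult_distrib)
  qed
  then show ?thesis unfolding a sum_distrib_left by (intro sum.cong) simp_all
qed

lemma homogeneous_poly_bound:
  assumes "homogeneous_poly d P"
  obtains M where "M > 0" "\<And>x y. \<bar>P x y\<bar> \<le> M * sqrt (x\<^sup>2 + y\<^sup>2) ^ d"
proof -
  obtain a where a: "\<And>x y. P x y = (\<Sum>i\<le>d. a i * x ^ i * y ^ (d - i))"
    using assms unfolding homogeneous_poly_def by auto
  \<comment> \<open>The summand 1 gives \<open>M > 0\<close>, as later estimates divide by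
    \<open>M\<close>.\<close>
  define M where "M = 1 + (\<Sum>i\<le>d. \<bar>a i\<bar>)"
  have "M > 0" unfolding M_def by (simp add: add_pos_nonneg sum_nonneg)
  moreover have "\<bar>P x y\<bar> \<le> M * sqrt (x\<^sup>2 + y\<^sup>2) ^ d" for x y
  proof -
    define r where "r = sqrt (x\<^sup>2 + y\<^sup>2)"
    have r: "\<bar>x\<bar> \<le> r" "\<bar>y\<bar> \<le> r" "0 \<le> r"
      unfolding r_def by (auto intro: real_le_rsqrt)
    have "\<bar>a i * x ^ i * y ^ (d - i)\<bar> \<le> \<bar>a i\<bar> * r ^ d" if "i \<le> d" for i
    proof -
      have "r ^ d = r ^ i * r ^ (d - i)"
        using that by (simp flip: power_add)
      moreover have "\<bar>x\<bar> ^ i * \<bar>y\<bar> ^ (d - i) \<le> r ^ i * r ^ (d - i)"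
        using r by (intro mult_mono power_mono) auto
      ultimately show ?thesis
        by (simp add: abs_mult power_abs mult.assoc mult_left_mono)
    qed
    then have "\<bar>P x y\<bar> \<le> (\<Sum>i\<le>d. \<bar>a i\<bar> * r ^ d)"
      unfolding a by (intro order_trans[OF sum_abs] sum_mono) auto
    also have "\<dots> \<le> M * r ^ d"
      using r(3) by (simp add: M_def flip: sum_distrib_right) (simp add: distrib_right)
    finally show ?thesis by (simp add: r_def)
  qed
  ultimately show ?thesis using that by blast
qed

section \<open>Partial derivatives, Euler's identity and the angular factor\<close>

definition perturbed_field :: "(real \<Rightarrow> real \<Rightarrow> real) \<Rightarrow> real \<times> real \<Rightarrow> real \<times> real" where
  "perturbed_field P = hamiltonian_field (\<lambda>x y. (x\<^sup>2 + y\<^sup>2) / 2 + P x y)"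

text \<open>Differentiability is encoded as the chain rule along differentiable curves. Curves
  parallel to the axes recover the partial derivatives of the Hamiltonian, and trajectories give
  energy conservation.\<close>

definition has_partials ::
    "(real \<Rightarrow> real \<Rightarrow> real) \<Rightarrow> (real \<Rightarrow> real \<Rightarrow> real) \<Rightarrow> (real \<Rightarrow> real \<Rightarrow> real) \<Rightarrow> bool" where
  "has_partials P Px Py \<longleftrightarrow> (\<forall>x y x' y' t I.
     (x has_real_derivative x') (at t within I) \<longrightarrow>
     (y has_real_derivative y') (at t within I) \<longrightarrow>
     ((\<lambda>t. P (x t) (y t)) has_real_derivative Px (x t) (y t) * x' + Py (x t) (y t) * y')
       (at t within I))"

lemma has_partials_chain:
  assumes "has_partials P Px Py" "(x has_real_derivative x') (at t within I)"
    "(y has_real_derivative y') (at t within I)"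
  shows "((\<lambda>t. P (x t) (y t)) has_real_derivative Px (x t) (y t) * x' + Py (x t) (y t) * y')
       (at t within I)"
  using assms unfolding has_partials_def by blast

lemma perturbed_field_partials:
  assumes "has_partials P Px Py"
  shows "perturbed_field P (x, y) = (- (y + Py x y), x + Px x y)"
proof -
  note chain = has_partials_chain[OF assms]
  have "((\<lambda>v. (x\<^sup>2 + v\<^sup>2) / 2 + P x v) has_real_derivative y + Py x y) (at y)"
    using chain[of "\<lambda>_. x" 0 y UNIV "\<lambda>v. v" 1] by (auto intro!: derivative_eq_intros)
  moreover have "((\<lambda>u. (u\<^sup>2 + y\<^sup>2) / 2 + P u y) has_real_derivative x + Px x y) (at x)"
    using chain[of "\<lambda>u. u" 1 x UNIV "\<lambda>_. y" 0] by (auto intro!: derivative_eq_intros)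
  ultimately show ?thesis
    unfolding perturbed_field_def hamiltonian_field_def by (simp add: DERIV_imp_deriv)
qed

text \<open>Termwise: x d/dx multiplies the monomial x^i y^(d-i) by i, and y d/dy multiplies it by d
  - i. Euler's identity later expresses the angular speed through \<open>P\<close> itself.\<close>

lemma homogeneous_poly_partials:
  assumes "homogeneous_poly d P"
  shows "\<exists>Px Py. has_partials P Px Py \<and> (\<forall>x y. x * Px x y + y * Py x y = real d * P x y)"
proof -
  obtain a where a: "\<And>x y. P x y = (\<Sum>i\<le>d. a i * x ^ i * y ^ (d - i))"
    using assms unfolding homogeneous_poly_def by auto
  define Px where "Px x y = (\<Sum>i\<le>d. a i * (real i * x ^ (i - 1)) * y ^ (d - i))" for x y
  define Py where "Py x y = (\<Sum>i\<le>d. a i * x ^ i * (real (d - i) * y ^ (d - i - 1)))" for x y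
  have chain: "((\<lambda>t. P (x t) (y t)) has_real_derivative Px (x t) (y t) * x' + Py (x t) (y t) * y')
      (at t within I)"
    if [derivative_intros]: "(x has_real_derivative x') (at t within I)"
      "(y has_real_derivative y') (at t within I)" for x y x' y' t I
      unfolding a Px_def Py_def sum_distrib_right sum.distrib[symmetric]
      by (auto intro!: derivative_eq_intros sum.cong simp: algebra_simps)
  show ?thesis
  proof (intro exI conjI allI)
    show "has_partials P Px Py"
      unfolding has_partials_def using chain by blast
  next
    fix x y
    have "x * (a i * (real i * x ^ (i - 1)) * y ^ (d - i)) +
      y * (a i * x ^ i * (real (d - i) * y ^ (d - i - 1))) = real d * (a i * x ^ i * y ^ (d - i))"
      if "i \<le> d" for i
    proof -
      \<comment> \<open>For \<open>i = 0\<close> the truncated exponent \<open>i - 1\<close> is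
        harmless because the factor \<open>real i\<close> vanishes; likewise for
        \<open>d - i\<close> below.\<close>
      have "x * (real i * x ^ (i - 1)) = real i * x ^ i" by (cases i) auto
      moreover have "y * (real (d - i) * y ^ (d - i - 1)) = real (d - i) * y ^ (d - i)"
        by (cases "d - i") auto
      ultimately have "a i * (x * (real i * x ^ (i - 1))) * y ^ (d - i) +
        a i * x ^ i * (y * (real (d - i) * y ^ (d - i - 1))) =
        (real i + real (d - i)) * (a i * x ^ i * y ^ (d - i))"
        by (simp only:) (simp add: algebra_simps)
      then have "x * (a i * (real i * x ^ (i - 1)) * y ^ (d - i)) +
        y * (a i * x ^ i * (real (d - i) * y ^ (d - i - 1))) =
        (real i + real (d - i)) * (a i * x ^ i * y ^ (d - i))"
        by (simp only: ac_simps)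
      then show ?thesis using that by (simp add: of_nat_diff)
    qed
    then show "x * Px x y + y * Py x y = real d * P x y"
      by (simp add: a Px_def Py_def sum_distrib_left flip: sum.distrib)
  qed
qed

lemma homogeneous_poly_rotate:
  assumes "homogeneous_poly d P"
  shows "homogeneous_poly d (\<lambda>x y. P (- x) (- y))"
proof -
  obtain a i where a: "\<And>x y. P x y = (\<Sum>i\<le>d. a i * x ^ i * y ^ (d - i))" and i: "i \<le> d" "a i \<noteq> 0"
    using assms unfolding homogeneous_poly_def by auto
  have "P (- x) (- y) = (\<Sum>i\<le>d. ((- 1) ^ d * a i) * x ^ i * y ^ (d - i))" for x y
    using homogeneous_poly_scale[OF assms, of "- 1" x y]
    by (simp add: a sum_distrib_left mult.assoc)
  then show ?thesis
    unfolding homogeneous_poly_def using i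
    by (intro exI[of _ "\<lambda>i. (- 1) ^ d * a i"]) auto
qed

text \<open>The trigonometric factor \<open>h\<close>: in polar coordinates a homogeneous
  \<open>P\<close> of degree \<open>d\<close> is \<open>r ^ d * angular P \<theta>\<close>.\<close>

definition angular :: "(real \<Rightarrow> real \<Rightarrow> real) \<Rightarrow> real \<Rightarrow> real" where
  "angular P \<theta> = P (cos \<theta>) (sin \<theta>)"

lemma continuous_on_angular:
  assumes "homogeneous_poly d P"
  shows "continuous_on A (angular P)"
proof -
  obtain a where a: "\<And>x y. P x y = (\<Sum>i\<le>d. a i * x ^ i * y ^ (d - i))"
    using assms unfolding homogeneous_poly_def by auto
  show ?thesis
    unfolding angular_def a by (intro continuous_intros)
qed

text \<open>Otherwise the continuous \<open>angular P\<close> would vanish on [0, pi], hence by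
  homogeneity \<open>P x 1 = 0\<close> for all \<open>x\<close>. This is a polynomial in
  \<open>x\<close> with the coefficients of \<open>P\<close>, one of which is nonzero.\<close>

lemma integral_angular_square_pos:
  assumes "homogeneous_poly d P"
  shows "integral {0..pi} (\<lambda>\<theta>. (angular P \<theta>)\<^sup>2) > 0"
proof (rule ccontr)
  assume *: "\<not> ?thesis"
  have cont: "continuous_on {0..pi} (\<lambda>\<theta>. (angular P \<theta>)\<^sup>2)"
    by (intro continuous_intros continuous_on_angular[OF assms])
  have "integral {0..pi} (\<lambda>\<theta>. (angular P \<theta>)\<^sup>2) \<ge> 0"
    by (intro integral_nonneg integrable_continuous_interval cont) auto
  with * have "integral {0..pi} (\<lambda>\<theta>. (angular P \<theta>)\<^sup>2) = 0" by simp
  then have zero: "angular P \<theta> = 0" if "\<theta> \<in> {0..pi}" for \<theta>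
    using integral_eq_0_iff[OF cont] that by auto
  obtain a i where a: "\<And>x y. P x y = (\<Sum>i\<le>d. a i * x ^ i * y ^ (d - i))" and i: "i \<le> d" "a i \<noteq> 0"
    using assms unfolding homogeneous_poly_def by auto
  have "P x 1 = 0" for x
  proof -
    \<comment> \<open>The polar angle of the point (x, 1).\<close>
    define \<theta> where "\<theta> = pi / 2 - arctan x"
    have "\<theta> \<in> {0..pi}"
      using arctan_lbound[of x] arctan_ubound[of x] unfolding \<theta>_def by auto
    moreover have "cos \<theta> = x / sqrt (1 + x\<^sup>2)" "sin \<theta> = 1 / sqrt (1 + x\<^sup>2)"
      unfolding \<theta>_def by (simp_all add: cos_diff sin_diff sin_arctan cos_arctan)
    moreover have "sqrt (1 + x\<^sup>2) > 0" by (simp add: add_pos_nonneg)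
    ultimately show ?thesis
      using zero[of \<theta>] homogeneous_poly_scale[OF assms, of "sqrt (1 + x\<^sup>2)" "cos \<theta>" "sin \<theta>"]
      by (simp add: angular_def)
  qed
  then have "\<forall>x. (\<Sum>i\<le>d. a i * x ^ i) = 0" by (simp add: a)
  then have "\<forall>i\<le>d. a i = 0" by (rule polyfun_eq_0[THEN iffD1])
  with i show False by auto
qed

section \<open>The time of an arc\<close>

text \<open>The mean value inequality holds between interior points and survives their passage to
  the ends. One-sided limits replace endpoint values because the formula for the polar angle divides
  by \<open>y\<close>, which vanishes at both ends of an arc.\<close>

lemma bounded_derivative_limits:
  fixes F F' :: "real \<Rightarrow> real"
  assumes "0 < T"
    and der: "\<And>t. t \<in> {0<..<T} \<Longrightarrow> (F has_real_derivative F' t) (at t)"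
    and bound: "\<And>t. t \<in> {0<..<T} \<Longrightarrow> \<bar>F' t\<bar> \<le> B"
    and l0: "(F \<longlongrightarrow> l0) (at_right 0)" and l1: "(F \<longlongrightarrow> l1) (at_left T)"
  shows "\<bar>l1 - l0\<bar> \<le> B * T"
proof -
  have B: "0 \<le> B" using bound[of "T/2"] \<open>0 < T\<close> by auto
  have le: "\<bar>F t - F s\<bar> \<le> B * T" if "s \<in> {0<..<T}" "t \<in> {0<..<T}" for s t
  proof -
    have "norm (F t - F s) \<le> B * norm (t - s)"
      using that der bound
      by (intro field_differentiable_bound[where S="{0<..<T}" and f'=F'])
        (auto intro: DERIV_subset)
    also have "\<dots> \<le> B * T" using B that by (intro mult_left_mono) auto
    finally show ?thesis by simp
  qed
  have "\<bar>l1 - F s\<bar> \<le> B * T" if "s \<in> {0<..<T}" for s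
  proof (rule tendsto_upperbound)
    show "((\<lambda>t. \<bar>F t - F s\<bar>) \<longlongrightarrow> \<bar>l1 - F s\<bar>) (at_left T)"
      by (intro tendsto_intros l1)
    show "\<forall>\<^sub>F t in at_left T. \<bar>F t - F s\<bar> \<le> B * T"
      using eventually_at_left_real[OF \<open>0 < T\<close>] le that by (auto elim: eventually_mono)
  qed auto
  note le' = this
  show ?thesis
  proof (rule tendsto_upperbound)
    show "((\<lambda>s. \<bar>l1 - F s\<bar>) \<longlongrightarrow> \<bar>l1 - l0\<bar>) (at_right 0)"
      by (intro tendsto_intros l0)
    show "\<forall>\<^sub>F s in at_right 0. \<bar>l1 - F s\<bar> \<le> B * T"
      using eventually_at_right_real[OF \<open>0 < T\<close>] le' by (auto elim: eventually_mono)
  qed auto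
qed

text \<open>With \<open>k = n - 1\<close> and \<open>\<phi> = \<epsilon> h\<close>, the first factor is the second order expansion of
  \<open>1/\<theta>'\<close> in \<open>\<epsilon>\<close> and the second one is \<open>\<theta>'\<close>.\<close>

lemma angle_expansion_error:
  fixes k :: nat
  assumes "\<eta> > 0"
  obtains \<delta> where "\<delta> > 0"
    "\<And>w \<phi>. \<bar>w\<bar> < \<delta> \<Longrightarrow> \<phi> = w * sqrt (1 + 2 * w) ^ k \<Longrightarrow>
       \<bar>1 - (1 - (real k + 2) * \<phi> + 2 * (real k + 1) * (real k + 2) * \<phi>\<^sup>2) * (1 + (real k + 2) * w)\<bar> \<le> \<eta> * w\<^sup>2"
proof -
  \<comment> \<open>By conservation of energy \<open>\<sigma> w\<close> is the ratio of
    \<open>\<rho> ^ k\<close> to \<open>r ^ k\<close>, which turns \<open>w = r ^ k * h\<close> into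
    \<open>\<phi> = \<rho> ^ k * h\<close>.\<close>
  define \<sigma> where "\<sigma> w = sqrt (1 + 2 * w) ^ k" for w :: real
  define K where "K w = 1 - (1 - (real k + 2) * (w * \<sigma> w) + 2 * (real k + 1) * (real k + 2) * (w * \<sigma> w)\<^sup>2) *
    (1 + (real k + 2) * w)" for w :: real
  have d: "(\<sigma> has_real_derivative real k) (at 0)"
    unfolding \<sigma>_def by (auto intro!: derivative_eq_intros)
  have s1: "(\<sigma> \<longlongrightarrow> 1) (at 0)"
    using DERIV_isCont[OF d] by (simp add: isCont_def \<sigma>_def)
  have s2: "((\<lambda>w. (\<sigma> w - 1) / w) \<longlongrightarrow> real k) (at 0)"
    using d by (simp add: DERIV_def \<sigma>_def)
  \<comment> \<open>This is \<open>K w\<close> divided by \<open>w\<^sup>2\<close>. Only the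
    derivative of \<open>\<sigma>\<close> at 0 enters the limit, and the coefficient
    \<open>2 * (k + 1) * (k + 2)\<close> is exactly the one that makes it vanish.\<close>
  have "((\<lambda>w. (real k + 2) * ((\<sigma> w - 1) / w) - 2 * (real k + 1) * (real k + 2) * (\<sigma> w)\<^sup>2 + (real k + 2)\<^sup>2 * \<sigma> w
      - 2 * (real k + 1) * (real k + 2)\<^sup>2 * w * (\<sigma> w)\<^sup>2) \<longlongrightarrow>
      (real k + 2) * real k - 2 * (real k + 1) * (real k + 2) * 1\<^sup>2 + (real k + 2)\<^sup>2 * 1
      - 2 * (real k + 1) * (real k + 2)\<^sup>2 * 0 * 1\<^sup>2) (at (0::real))"
    by (intro tendsto_intros s1 s2)
  also have "(real k + 2) * real k - 2 * (real k + 1) * (real k + 2) * 1\<^sup>2 + (real k + 2)\<^sup>2 * 1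
      - 2 * (real k + 1) * (real k + 2)\<^sup>2 * 0 * 1\<^sup>2 = 0"
    by (simp add: algebra_simps power2_eq_square)
  finally have "((\<lambda>w. K w / w\<^sup>2) \<longlongrightarrow> 0) (at 0)"
  proof (rule Lim_transform_eventually)
    show "\<forall>\<^sub>F w in at 0. (real k + 2) * ((\<sigma> w - 1) / w) - 2 * (real k + 1) * (real k + 2) * (\<sigma> w)\<^sup>2
      + (real k + 2)\<^sup>2 * \<sigma> w - 2 * (real k + 1) * (real k + 2)\<^sup>2 * w * (\<sigma> w)\<^sup>2 = K w / w\<^sup>2"
      unfolding eventually_at K_def
      by (intro exI[of _ 1]) (auto simp: field_simps power2_eq_square)
  qed
  then have "\<forall>\<^sub>F w in at 0. \<bar>K w / w\<^sup>2\<bar> < \<eta>"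
    using assms by (auto simp: tendsto_iff)
  then obtain \<delta> where \<delta>: "\<delta> > 0" "\<And>w. w \<noteq> 0 \<Longrightarrow> \<bar>w\<bar> < \<delta> \<Longrightarrow> \<bar>K w / w\<^sup>2\<bar> < \<eta>"
    unfolding eventually_at by auto
  have "\<bar>K w\<bar> \<le> \<eta> * w\<^sup>2" if "\<bar>w\<bar> < \<delta>" for w
  proof (cases "w = 0")
    case False
    then show ?thesis using \<delta>(2)[OF False that] by (simp add: field_simps)
  qed (simp add: K_def)
  with \<delta>(1) show ?thesis
    by (intro that[of \<delta>]) (auto simp: K_def \<sigma>_def)
qed

section \<open>Conserved energy, polar angle and the time of an upper arc\<close>

lemma trajectory_components:
  assumes "trajectory_on X I \<gamma>" "t \<in> I"
  shows "((\<lambda>t. fst (\<gamma> t)) has_real_derivative fst (X (\<gamma> t))) (at t within I)"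
    and "((\<lambda>t. snd (\<gamma> t)) has_real_derivative snd (X (\<gamma> t))) (at t within I)"
proof -
  have "(\<gamma> has_vector_derivative X (\<gamma> t)) (at t within I)"
    using assms unfolding trajectory_on_def by blast
  from bounded_linear.has_vector_derivative[OF bounded_linear_fst this]
    bounded_linear.has_vector_derivative[OF bounded_linear_snd this]
  show "((\<lambda>t. fst (\<gamma> t)) has_real_derivative fst (X (\<gamma> t))) (at t within I)"
    and "((\<lambda>t. snd (\<gamma> t)) has_real_derivative snd (X (\<gamma> t))) (at t within I)"
    by (simp_all add: has_real_derivative_iff_has_vector_derivative)
qed

text \<open>Twice the Hamiltonian, so that its square root is asymptotic to the polar radius.\<close>

definition energy :: "(real \<Rightarrow> real \<Rightarrow> real) \<Rightarrow> real \<Rightarrow> real \<Rightarrow> real" where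
  "energy P x y = x\<^sup>2 + y\<^sup>2 + 2 * P x y"

lemma energy_conserved:
  assumes hom: "homogeneous_poly d P"
    and traj: "trajectory_on (perturbed_field P) {0..T} \<gamma>" and t: "t \<in> {0..T}"
  shows "energy P (fst (\<gamma> t)) (snd (\<gamma> t)) = energy P (fst (\<gamma> 0)) (snd (\<gamma> 0))"
proof -
  obtain Px Py where P': "has_partials P Px Py"
    using homogeneous_poly_partials[OF hom] by blast
  have field': "perturbed_field P z = (- (snd z + Py (fst z) (snd z)), fst z + Px (fst z) (snd z))" for z
    using perturbed_field_partials[OF P', of "fst z" "snd z"] by simp
  have "((\<lambda>t. energy P (fst (\<gamma> t)) (snd (\<gamma> t))) has_real_derivative 0) (at s within {0..T})"
    if "s \<in> {0..T}" for s
    unfolding energy_def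
    using trajectory_components[OF traj that]
    by (auto simp: field' algebra_simps intro!: derivative_eq_intros has_partials_chain[OF P'])
  then obtain c where "\<And>s. s \<in> {0..T} \<Longrightarrow> energy P (fst (\<gamma> s)) (snd (\<gamma> s)) = c"
    using has_field_derivative_zero_constant[of "{0..T}"
        "\<lambda>t. energy P (fst (\<gamma> t)) (snd (\<gamma> t))"] by auto
  with t show ?thesis by simp
qed

text \<open>\<open>pi / 2 - arctan (x / y)\<close> is the arccotangent of \<open>x / y\<close>, a
  single smooth formula for the polar angle on the whole open upper half plane.\<close>

lemma polar_angle:
  fixes x y :: real
  assumes "y > 0"
  shows "cos (pi / 2 - arctan (x / y)) = x / sqrt (x\<^sup>2 + y\<^sup>2)"
    and "sin (pi / 2 - arctan (x / y)) = y / sqrt (x\<^sup>2 + y\<^sup>2)"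
proof -
  have "1 + (x / y)\<^sup>2 = (x\<^sup>2 + y\<^sup>2) / y\<^sup>2"
    using assms by (simp add: field_simps)
  then have "sqrt (1 + (x / y)\<^sup>2) = sqrt (x\<^sup>2 + y\<^sup>2) / y"
    using assms by (simp add: real_sqrt_divide)
  then show "cos (pi / 2 - arctan (x / y)) = x / sqrt (x\<^sup>2 + y\<^sup>2)"
    and "sin (pi / 2 - arctan (x / y)) = y / sqrt (x\<^sup>2 + y\<^sup>2)"
    using assms by (simp_all add: cos_diff sin_diff sin_arctan cos_arctan)
qed

text \<open>Integrating from \<open>a - 1\<close> makes the derivative two-sided even at the
  endpoints, as composition with the angle and continuity at 0 and pi require.\<close>

lemma antiderivative_on_line:
  fixes g :: "real \<Rightarrow> real"
  assumes "a \<le> b" and cont: "\<And>A. continuous_on A g"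
  obtains G where "\<And>x. x \<in> {a..b} \<Longrightarrow> (G has_real_derivative g x) (at x)"
    "G a = 0" "G b = integral {a..b} g"
proof
  define G where "G x = integral {a - 1..x} g - integral {a - 1..a} g" for x
  show "(G has_real_derivative g x) (at x)" if "x \<in> {a..b}" for x
  proof -
    have "((\<lambda>x. integral {a - 1..x} g) has_real_derivative g x) (at x within {a - 1..b + 1})"
      using that by (intro integral_has_real_derivative cont) auto
    moreover have "at x within {a - 1..b + 1} = at x"
      using that by (intro at_within_interior) auto
    ultimately show ?thesis
      unfolding G_def by (auto intro!: derivative_eq_intros)
  qed
  show "G a = 0" by (simp add: G_def)
  show "G b = integral {a..b} g"
    using Henstock_Kurzweil_Integration.integral_combine[of "a - 1" a b g] assms
    by (simp add: G_def integrable_continuous_interval)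
qed

text \<open>The quantity \<rho>: constant along an arc, unlike the polar radius, with which it
  agrees to leading order.\<close>

definition radius :: "(real \<Rightarrow> real \<Rightarrow> real) \<Rightarrow> real \<Rightarrow> real" where
  "radius P p = sqrt (energy P p 0)"

text \<open>Here \<open>k = n - 1\<close>; as \<open>k \<ge> 1\<close>, the ratio of
  \<open>P\<close> to the squared radius tends to 0 at the origin, so the arc is a small
  perturbation of a half circle. The bound \<open>\<delta>\<close> is uniform over all arcs. The
  claims about \<open>q\<close> serve to compare arcs parametrised by opposite ends.\<close>

lemma upper_arc_time:
  fixes k :: nat
  assumes hom: "homogeneous_poly (k + 2) P" and k: "1 \<le> k" and \<eta>: "\<eta> > 0"
  shows "\<exists>\<delta>>0. \<forall>p q T. 0 < p \<longrightarrow> p < \<delta> \<longrightarrow> q < 0 \<longrightarrow>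
    arc_through (perturbed_field P) {(x, y). y > 0} p q T \<longrightarrow>
      \<bar>T - pi + (real k + 2) * integral {0..pi} (angular P) * radius P p ^ k
        - 2 * (real k + 1) * (real k + 2) * integral {0..pi} (\<lambda>\<theta>. (angular P \<theta>)\<^sup>2)
          * (radius P p ^ k)\<^sup>2\<bar> \<le> \<eta> * (radius P p ^ k)\<^sup>2
      \<and> energy P q 0 = energy P p 0 \<and> q\<^sup>2 \<le> 4 * p\<^sup>2"
proof -
  obtain M where M: "M > 0" "\<And>x y. \<bar>P x y\<bar> \<le> M * sqrt (x\<^sup>2 + y\<^sup>2) ^ (k + 2)"
    using homogeneous_poly_bound[OF hom] by blast
  obtain Px Py where P': "has_partials P Px Py"
    and euler: "\<And>x y. x * Px x y + y * Py x y = real (k + 2) * P x y"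
    using homogeneous_poly_partials[OF hom] by blast
  have field': "perturbed_field P z = (- (snd z + Py (fst z) (snd z)), fst z + Px (fst z) (snd z))" for z
    using perturbed_field_partials[OF P', of "fst z" "snd z"] by simp
  obtain A1 where A1: "\<And>\<theta>. \<theta> \<in> {0..pi} \<Longrightarrow> (A1 has_real_derivative angular P \<theta>) (at \<theta>)"
    "A1 0 = 0" "A1 pi = integral {0..pi} (angular P)"
    by (rule antiderivative_on_line[of 0 pi "angular P"])
      (use continuous_on_angular[OF hom] in auto)
  obtain A2 where A2: "\<And>\<theta>. \<theta> \<in> {0..pi} \<Longrightarrow> (A2 has_real_derivative (angular P \<theta>)\<^sup>2) (at \<theta>)"
    "A2 0 = 0" "A2 pi = integral {0..pi} (\<lambda>\<theta>. (angular P \<theta>)\<^sup>2)"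
    by (rule antiderivative_on_line[of 0 pi "\<lambda>\<theta>. (angular P \<theta>)\<^sup>2"])
      (use continuous_on_angular[OF hom] in \<open>auto intro!: continuous_intros\<close>)
  \<comment> \<open>Normalised so that the bounds
    \<open>(w t)\<^sup>2 \<le> M\<^sup>2 * 2 ^ k * \<epsilon>\<^sup>2\<close> and
    \<open>T \<le> 2 * pi\<close> found below yield exactly
    \<open>\<eta> * \<epsilon>\<^sup>2\<close>.\<close>
  define \<eta>' where "\<eta>' = \<eta> / (M\<^sup>2 * 2 ^ k * (2 * pi))"
  have \<eta>': "\<eta>' > 0" "\<eta>' * (M\<^sup>2 * 2 ^ k * (2 * pi)) = \<eta>"
    using \<eta> M(1) by (simp_all add: \<eta>'_def)
  obtain \<delta>w where \<delta>w: "\<delta>w > 0"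
    "\<And>w \<phi>. \<bar>w\<bar> < \<delta>w \<Longrightarrow> \<phi> = w * sqrt (1 + 2 * w) ^ k \<Longrightarrow>
       \<bar>1 - (1 - (real k + 2) * \<phi> + 2 * (real k + 1) * (real k + 2) * \<phi>\<^sup>2) * (1 + (real k + 2) * w)\<bar>
         \<le> \<eta>' * w\<^sup>2"
    using angle_expansion_error[OF \<eta>'(1), of k] by metis
  \<comment> \<open>A bound for |w| along the arc: small enough for the expansion error, and keeping
    the angular speed within 1/4 of 1.\<close>
  define \<mu> where "\<mu> = min (\<delta>w / 2) (1 / (4 * (real k + 2)))"
  have \<mu>: "\<mu> > 0" "\<mu> < \<delta>w" "(real k + 2) * \<mu> \<le> 1 / 4"
  proof -
    show "\<mu> > 0" "\<mu> < \<delta>w" using \<delta>w(1) unfolding \<mu>_def by auto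
    have "(real k + 2) * \<mu> \<le> (real k + 2) * (1 / (4 * (real k + 2)))"
      unfolding \<mu>_def by (intro mult_left_mono) auto
    also have "\<dots> = 1 / 4" by (simp add: field_simps)
    finally show "(real k + 2) * \<mu> \<le> 1 / 4" .
  qed
  have "2 * \<mu> \<le> (real k + 2) * \<mu>" using \<mu>(1) by (intro mult_right_mono) auto
  then have \<mu>8: "\<mu> \<le> 1 / 8" using \<mu>(3) by linarith
  \<comment> \<open>Since \<open>r0 \<le> 1\<close> and \<open>k \<ge> 1\<close>, also
    \<open>r0 ^ k \<le> \<mu> / M\<close>, so |P| is at most \<mu> times the squared radius within
    radius \<open>r0\<close>.\<close>
  define r0 where "r0 = min 1 (\<mu> / M)"
  have r0: "r0 > 0" "r0 \<le> 1" using \<mu>(1) M(1) unfolding r0_def by auto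
  have Mr0: "M * r0 ^ k \<le> \<mu>"
  proof -
    have "r0 ^ k \<le> r0 ^ 1" using r0 k by (intro power_decreasing) auto
    also have "\<dots> \<le> \<mu> / M" by (simp add: r0_def)
    finally show ?thesis using M(1) by (simp add: field_simps)
  qed
  have near: "\<bar>P x y\<bar> \<le> M * sqrt (x\<^sup>2 + y\<^sup>2) ^ k * (x\<^sup>2 + y\<^sup>2)" for x y
    using M(2)[of x y]
    by (simp only: power_add real_sqrt_pow2[OF sum_power2_ge_zero] mult.assoc)
  have near': "\<bar>P x y\<bar> \<le> \<mu> * (x\<^sup>2 + y\<^sup>2)" if "x\<^sup>2 + y\<^sup>2 \<le> r0\<^sup>2" for x y
  proof -
    have "sqrt (x\<^sup>2 + y\<^sup>2) \<le> r0" using that r0 by (intro real_le_lsqrt) auto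
    then have "M * sqrt (x\<^sup>2 + y\<^sup>2) ^ k \<le> M * r0 ^ k"
      using M(1) by (intro mult_left_mono power_mono) auto
    then have "M * sqrt (x\<^sup>2 + y\<^sup>2) ^ k * (x\<^sup>2 + y\<^sup>2) \<le> \<mu> * (x\<^sup>2 + y\<^sup>2)"
      using Mr0 by (intro mult_right_mono) auto
    with near[of x y] show ?thesis by linarith
  qed
  have energy_bounds: "(x\<^sup>2 + y\<^sup>2) / 2 \<le> energy P x y" "energy P x y \<le> 3 / 2 * (x\<^sup>2 + y\<^sup>2)"
    if "x\<^sup>2 + y\<^sup>2 \<le> r0\<^sup>2" for x y
  proof -
    have "\<mu> * (x\<^sup>2 + y\<^sup>2) \<le> 1 / 8 * (x\<^sup>2 + y\<^sup>2)" using \<mu>8 by (intro mult_right_mono) auto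
    with near'[OF that] have P: "\<bar>P x y\<bar> \<le> (x\<^sup>2 + y\<^sup>2) / 8" by linarith
    have nonneg: "x\<^sup>2 + y\<^sup>2 \<ge> 0" by simp
    show "(x\<^sup>2 + y\<^sup>2) / 2 \<le> energy P x y"
      using P nonneg unfolding energy_def by argo
    show "energy P x y \<le> 3 / 2 * (x\<^sup>2 + y\<^sup>2)"
      using P nonneg unfolding energy_def by argo
  qed
  show ?thesis
  proof (intro exI[of _ "r0 / 2"] conjI allI impI)
    fix p q T
    assume p: "0 < p" "p < r0 / 2" and q: "q < 0"
      and arc: "arc_through (perturbed_field P) {(x, y). y > 0} p q T"
    then obtain \<gamma> where T: "0 < T" and traj: "trajectory_on (perturbed_field P) {0..T} \<gamma>"
      and ends: "\<gamma> 0 = (p, 0)" "\<gamma> T = (q, 0)" and up: "\<And>t. t \<in> {0<..<T} \<Longrightarrow> snd (\<gamma> t) > 0"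
      unfolding arc_through_def by force
    define x where "x t = fst (\<gamma> t)" for t
    define y where "y t = snd (\<gamma> t)" for t
    define \<rho> where "\<rho> = radius P p"
    have x': "(x has_real_derivative - (y t + Py (x t) (y t))) (at t within {0..T})"
      and y': "(y has_real_derivative x t + Px (x t) (y t)) (at t within {0..T})"
      if "t \<in> {0..T}" for t
      using trajectory_components[OF traj that] by (simp_all add: field' x_def[abs_def] y_def[abs_def])
    have conserved: "energy P (x t) (y t) = energy P p 0" if "t \<in> {0..T}" for t
      using energy_conserved[OF hom traj that] by (simp add: x_def y_def ends)
    have xy: "x 0 = p" "y 0 = 0" "x T = q" "y T = 0" by (simp_all add: x_def y_def ends)
    have cx: "continuous_on {0..T} x" and cy: "continuous_on {0..T} y"
      by (rule DERIV_continuous_on, erule x', rule DERIV_continuous_on, erule y')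
    have p_small: "p\<^sup>2 + 0\<^sup>2 \<le> r0\<^sup>2" using p by (auto intro!: power_mono)
    have p4: "p\<^sup>2 < r0\<^sup>2 / 4"
      using power_strict_mono[of p "r0 / 2" 2] p by (simp add: power_divide)
    \<comment> \<open>Confinement by conservation: at radius \<open>r0\<close> the energy would be
      at least \<open>r0\<^sup>2 / 2\<close>, but it is at most \<open>3 / 2 * p\<^sup>2\<close>,
      which is below \<open>3 / 8 * r0\<^sup>2\<close>.\<close>
    have small: "(x t)\<^sup>2 + (y t)\<^sup>2 < r0\<^sup>2" if t: "t \<in> {0..T}" for t
    proof (rule ccontr)
      assume "\<not> ?thesis"
      moreover have "continuous_on {0..t} (\<lambda>t. (x t)\<^sup>2 + (y t)\<^sup>2)"
        using t by (intro continuous_intros continuous_on_subset[OF cx] continuous_on_subset[OF cy]) auto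
      ultimately obtain s where s: "0 \<le> s" "s \<le> t" "(x s)\<^sup>2 + (y s)\<^sup>2 = r0\<^sup>2"
        using IVT'[of "\<lambda>t. (x t)\<^sup>2 + (y t)\<^sup>2" 0 "r0\<^sup>2" t] t p_small xy by auto
      then have "r0\<^sup>2 / 2 \<le> energy P p 0"
        using energy_bounds(1)[of "x s" "y s"] conserved[of s] t by auto
      with energy_bounds(2)[OF p_small] p4 zero_less_power[OF r0(1), of 2]
      show False by auto
    qed
    have "0 < p\<^sup>2 / 2" using p by simp
    also have "\<dots> \<le> energy P p 0" using energy_bounds(1)[OF p_small] by simp
    finally have Epos: "energy P p 0 > 0" .
    have \<rho>: "\<rho> > 0" "\<rho>\<^sup>2 = energy P p 0" using Epos by (simp_all add: \<rho>_def radius_def)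
    show Eq: "energy P q 0 = energy P p 0"
      using conserved[of T] T xy by simp
    have "q\<^sup>2 / 2 \<le> 3 / 2 * p\<^sup>2"
      using energy_bounds(1)[of "x T" "y T"] small[of T] T energy_bounds(2)[OF p_small] Eq xy by auto
    then show "q\<^sup>2 \<le> 4 * p\<^sup>2" using zero_le_power2[of p] by argo
    \<comment> \<open>At the ends of the arc division by zero gives the meaningless value
      \<open>pi / 2\<close>, so only limits of \<theta> are taken there.\<close>
    define \<theta> where "\<theta> t = pi / 2 - arctan (x t / y t)" for t
    define w where "w t = P (x t) (y t) / ((x t)\<^sup>2 + (y t)\<^sup>2)" for t
    define h where "h t = angular P (\<theta> t)" for t
    define \<epsilon> where "\<epsilon> = \<rho> ^ k"
    have \<epsilon>: "\<epsilon> > 0" using \<rho> by (simp add: \<epsilon>_def)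
    have \<theta>_range: "\<theta> t \<in> {0..pi}" for t
      using arctan_lbound[of "x t / y t"] arctan_ubound[of "x t / y t"] unfolding \<theta>_def by auto
    have y_pos: "y t > 0" if "t \<in> {0<..<T}" for t
      using up[OF that] by (simp add: y_def)
    have r_pos: "(x t)\<^sup>2 + (y t)\<^sup>2 > 0" if "t \<in> {0<..<T}" for t
      using y_pos[OF that] by (intro add_nonneg_pos) auto
    have w_bound: "\<bar>w t\<bar> \<le> \<mu>" and w_bound': "\<bar>w t\<bar> \<le> M * sqrt ((x t)\<^sup>2 + (y t)\<^sup>2) ^ k"
      if "t \<in> {0<..<T}" for t
      using near'[of "x t" "y t"] near[of "x t" "y t"] small[of t] r_pos[OF that] that
      by (auto simp: w_def abs_divide divide_le_eq)
    have r_ne: "(x t)\<^sup>2 + (y t)\<^sup>2 \<noteq> 0" if "t \<in> {0<..<T}" for t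
      using r_pos[OF that] by (rule less_imp_neq[THEN not_sym])
    have Pw: "P (x t) (y t) = ((x t)\<^sup>2 + (y t)\<^sup>2) * w t" if "t \<in> {0<..<T}" for t
      by (simp only: w_def times_divide_eq_right nonzero_mult_div_cancel_left[OF r_ne[OF that]])
    have w_eq: "w t = sqrt ((x t)\<^sup>2 + (y t)\<^sup>2) ^ k * h t" if "t \<in> {0<..<T}" for t
    proof -
      define r where "r = sqrt ((x t)\<^sup>2 + (y t)\<^sup>2)"
      have r: "r > 0" "r\<^sup>2 = (x t)\<^sup>2 + (y t)\<^sup>2" using r_pos[OF that] by (auto simp: r_def)
      have "P (r * (x t / r)) (r * (y t / r)) = r ^ (k + 2) * h t"
        by (simp only: h_def angular_def \<theta>_def r_def polar_angle[OF y_pos[OF that]]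
            homogeneous_poly_scale[OF hom])
      then have "P (x t) (y t) = r ^ k * h t * r\<^sup>2" using r by (simp add: power_add mult_ac power2_eq_square)
      then have "w t = r ^ k * h t * r\<^sup>2 / r\<^sup>2" by (simp only: w_def r(2))
      also have "\<dots> = r ^ k * h t" using r(1) by simp
      finally show ?thesis by (simp only: r_def)
    qed
    have \<epsilon>h: "\<epsilon> * h t = w t * sqrt (1 + 2 * w t) ^ k" if t: "t \<in> {0<..<T}" for t
    proof -
      have "energy P p 0 = energy P (x t) (y t)" using conserved[of t] t by simp
      also have "\<dots> = ((x t)\<^sup>2 + (y t)\<^sup>2) * (1 + 2 * w t)"
        by (simp only: energy_def Pw[OF t]) (simp add: algebra_simps)
      finally have "\<rho> = sqrt ((x t)\<^sup>2 + (y t)\<^sup>2) * sqrt (1 + 2 * w t)"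
        by (simp add: \<rho>_def radius_def real_sqrt_mult)
      then show ?thesis by (simp add: \<epsilon>_def w_eq[OF t] power_mult_distrib)
    qed
    \<comment> \<open>The angular speed is (x y' - y x') / r^2; Euler's identity turns x Px + y Py
      into (k + 2) P.\<close>
    have \<theta>': "(\<theta> has_real_derivative 1 + (real k + 2) * w t) (at t)" if t: "t \<in> {0<..<T}" for t
    proof -
      have "at t within {0..T} = at t" using t by (intro at_within_interior) auto
      then have [derivative_intros]: "(x has_real_derivative - (y t + Py (x t) (y t))) (at t)"
        "(y has_real_derivative x t + Px (x t) (y t)) (at t)"
        using x'[of t] y'[of t] t by auto
      have "(\<theta> has_real_derivative
          - ((- (y t + Py (x t) (y t)) * y t - x t * (x t + Px (x t) (y t))) / (y t * y t))
            / (1 + (x t / y t)\<^sup>2)) (at t)"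
        unfolding \<theta>_def[abs_def] using y_pos[OF t]
        by (auto intro!: derivative_eq_intros simp: divide_simps)
      also have "- ((- (y t + Py (x t) (y t)) * y t - x t * (x t + Px (x t) (y t))) / (y t * y t))
            / (1 + (x t / y t)\<^sup>2) =
          ((x t)\<^sup>2 + (y t)\<^sup>2 + (x t * Px (x t) (y t) + y t * Py (x t) (y t))) / ((x t)\<^sup>2 + (y t)\<^sup>2)"
      proof -
        have "1 + (x t / y t)\<^sup>2 = ((x t)\<^sup>2 + (y t)\<^sup>2) / (y t * y t)"
          using y_pos[OF t] by (simp add: field_simps power2_eq_square)
        moreover have "- (a / c) / (b / c) = - a / b" if "c \<noteq> 0" for a b c :: real
          using that by simp
        moreover have "- (- (y t + Py (x t) (y t)) * y t - x t * (x t + Px (x t) (y t))) =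
            (x t)\<^sup>2 + (y t)\<^sup>2 + (x t * Px (x t) (y t) + y t * Py (x t) (y t))"
          by (simp add: algebra_simps power2_eq_square)
        moreover have "y t * y t \<noteq> 0" using y_pos[OF t] by simp
        ultimately show ?thesis by metis
      qed
      also have "(x t)\<^sup>2 + (y t)\<^sup>2 + (x t * Px (x t) (y t) + y t * Py (x t) (y t)) =
          ((x t)\<^sup>2 + (y t)\<^sup>2) * (1 + (real k + 2) * w t)"
        by (simp only: euler Pw[OF t]) (simp add: algebra_simps)
      also have "\<dots> / ((x t)\<^sup>2 + (y t)\<^sup>2) = 1 + (real k + 2) * w t"
        by (rule nonzero_mult_div_cancel_left[OF r_ne[OF t]])
      finally show ?thesis .
    qed
    have t0: "\<forall>\<^sub>F t in at_right 0. t \<in> {0<..<T}" and t1: "\<forall>\<^sub>F t in at_left T. t \<in> {0<..<T}"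
      using eventually_at_right_real[OF T] eventually_at_left_real[OF T] by auto
    have "at 0 within {0..T} = at_right 0" "at T within {0..T} = at_left T"
      using T by (simp_all add: at_within_Icc_at_right at_within_Icc_at_left)
    then have lim0: "(x \<longlongrightarrow> p) (at_right 0)" "(y \<longlongrightarrow> 0) (at_right 0)"
      and lim1: "(x \<longlongrightarrow> q) (at_left T)" "(y \<longlongrightarrow> 0) (at_left T)"
      using cx[unfolded continuous_on_def, rule_format, of 0] cx[unfolded continuous_on_def, rule_format, of T]
        cy[unfolded continuous_on_def, rule_format, of 0] cy[unfolded continuous_on_def, rule_format, of T] T xy
      by auto
    \<comment> \<open>As \<open>y\<close> tends to 0 from above, \<open>x / y\<close> tends to
      infinity at the start because \<open>p > 0\<close>, and to minus infinity at the end because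
      \<open>q < 0\<close>: the arc makes one half turn.\<close>
    have \<theta>0: "(\<theta> \<longlongrightarrow> 0) (at_right 0)"
    proof -
      have "filterlim (\<lambda>t. x t / y t) at_top (at_right 0)"
        using t0 y_pos p by (intro LIM_at_top_divide[OF lim0(1) _ lim0(2)]) (auto elim: eventually_mono)
      then have "((\<lambda>t. arctan (x t / y t)) \<longlongrightarrow> pi / 2) (at_right 0)"
        by (rule filterlim_compose[OF tendsto_arctan_at_top])
      from tendsto_diff[OF tendsto_const[of "pi / 2"] this] show ?thesis
        by (simp add: \<theta>_def[abs_def])
    qed
    have \<theta>1: "(\<theta> \<longlongrightarrow> pi) (at_left T)"
    proof -
      have "filterlim (\<lambda>t. - x t / y t) at_top (at_left T)"
        using t1 y_pos q
        by (intro LIM_at_top_divide[OF tendsto_minus[OF lim1(1)] _ lim1(2)]) (auto elim: eventually_mono)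
      then have "((\<lambda>t. arctan (- x t / y t)) \<longlongrightarrow> pi / 2) (at_left T)"
        by (rule filterlim_compose[OF tendsto_arctan_at_top])
      from tendsto_add[OF tendsto_const[of "pi / 2"] this] show ?thesis
        by (simp add: \<theta>_def[abs_def] arctan_minus)
    qed
    \<comment> \<open>A crude bound on \<open>T\<close> comes first; it later converts a bound on a
      derivative into one over the whole arc.\<close>
    have "\<bar>(pi - T) - (0 - 0)\<bar> \<le> 1 / 2 * T"
    proof (rule bounded_derivative_limits[OF T, where F="\<lambda>t. \<theta> t - t" and F'="\<lambda>t. (real k + 2) * w t"])
      fix t assume t: "t \<in> {0<..<T}"
      show "((\<lambda>t. \<theta> t - t) has_real_derivative (real k + 2) * w t) (at t)"
        by (auto intro!: derivative_eq_intros \<theta>'[OF t])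
      have "\<bar>(real k + 2) * w t\<bar> \<le> (real k + 2) * \<mu>"
        unfolding abs_mult using w_bound[OF t] by (intro mult_mono) auto
      with \<mu>(3) show "\<bar>(real k + 2) * w t\<bar> \<le> 1 / 2" by linarith
    qed (intro tendsto_intros \<theta>0 \<theta>1)+
    then have T2: "T \<le> 2 * pi" by linarith
    \<comment> \<open>\<open>G\<close> integrates the expansion of dt/d\<theta> over the angle;
      \<open>G pi\<close> is the claimed value of the time.\<close>
    define G where "G \<phi> = \<phi> - (real k + 2) * \<epsilon> * A1 \<phi> + 2 * (real k + 1) * (real k + 2) * \<epsilon>\<^sup>2 * A2 \<phi>" for \<phi>
    have G': "(G has_real_derivative
        1 - (real k + 2) * (\<epsilon> * angular P \<phi>) + 2 * (real k + 1) * (real k + 2) * (\<epsilon> * angular P \<phi>)\<^sup>2) (at \<phi>)"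
      if "\<phi> \<in> {0..pi}" for \<phi>
      unfolding G_def
      by (auto intro!: derivative_eq_intros A1(1)[OF that] A2(1)[OF that] simp: power_mult_distrib)
    have G_cont: "isCont G 0" "isCont G pi" by (auto intro!: DERIV_isCont G')
    txt \<open>Instead of changing variables from \<open>t\<close> to \<open>\<theta>\<close>, bound the derivative of \<open>t - G(\<theta>(t))\<close>.\<close>
    have "\<bar>(T - G pi) - (0 - G 0)\<bar> \<le> \<eta>' * (M\<^sup>2 * 2 ^ k * \<epsilon>\<^sup>2) * T"
    proof (rule bounded_derivative_limits[OF T, where F="\<lambda>t. t - G (\<theta> t)" and
        F'="\<lambda>t. 1 - (1 - (real k + 2) * (\<epsilon> * h t) + 2 * (real k + 1) * (real k + 2) * (\<epsilon> * h t)\<^sup>2)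
          * (1 + (real k + 2) * w t)"])
      fix t assume t: "t \<in> {0<..<T}"
      show "((\<lambda>t. t - G (\<theta> t)) has_real_derivative
          1 - (1 - (real k + 2) * (\<epsilon> * h t) + 2 * (real k + 1) * (real k + 2) * (\<epsilon> * h t)\<^sup>2)
          * (1 + (real k + 2) * w t)) (at t)"
        unfolding h_def
        by (intro DERIV_diff DERIV_ident DERIV_chain2[OF G'[OF \<theta>_range] \<theta>'[OF t]])
      \<comment> \<open>The polar radius varies along the arc; energy bounds its square by
        \<open>2 * \<rho>\<^sup>2\<close>, which is constant.\<close>
      have "(w t)\<^sup>2 \<le> (M * sqrt ((x t)\<^sup>2 + (y t)\<^sup>2) ^ k)\<^sup>2"
        using power_mono[OF w_bound'[OF t], of 2] by simp
      also have "\<dots> = M\<^sup>2 * ((x t)\<^sup>2 + (y t)\<^sup>2) ^ k"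
        by (simp add: power_mult_distrib flip: power_mult[of _ k 2] power_mult[of _ 2 k])
          (simp add: mult.commute[of k 2] power_mult)
      also have "\<dots> \<le> M\<^sup>2 * (2 * \<rho>\<^sup>2) ^ k"
        using energy_bounds(1)[of "x t" "y t"] small[of t] conserved[of t] t \<rho>(2)
        by (intro mult_left_mono power_mono) auto
      also have "\<dots> = M\<^sup>2 * 2 ^ k * \<epsilon>\<^sup>2"
        by (simp add: \<epsilon>_def power_mult_distrib flip: power_mult) (simp add: mult.commute)
      finally have "\<eta>' * (w t)\<^sup>2 \<le> \<eta>' * (M\<^sup>2 * 2 ^ k * \<epsilon>\<^sup>2)"
        using \<eta>'(1) by (intro mult_left_mono) auto
      moreover have "\<bar>w t\<bar> < \<delta>w" using w_bound[OF t] \<mu>(2) by linarith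
      ultimately show "\<bar>1 - (1 - (real k + 2) * (\<epsilon> * h t) + 2 * (real k + 1) * (real k + 2) * (\<epsilon> * h t)\<^sup>2)
          * (1 + (real k + 2) * w t)\<bar> \<le> \<eta>' * (M\<^sup>2 * 2 ^ k * \<epsilon>\<^sup>2)"
        using \<delta>w(2)[of "w t" "\<epsilon> * h t"] \<epsilon>h[OF t] by linarith
    next
      show "((\<lambda>t. t - G (\<theta> t)) \<longlongrightarrow> 0 - G 0) (at_right 0)"
        by (intro tendsto_intros isCont_tendsto_compose[OF G_cont(1)] \<theta>0)
      show "((\<lambda>t. t - G (\<theta> t)) \<longlongrightarrow> T - G pi) (at_left T)"
        by (intro tendsto_intros isCont_tendsto_compose[OF G_cont(2)] \<theta>1)
    qed
    also have "\<dots> \<le> \<eta>' * (M\<^sup>2 * 2 ^ k * \<epsilon>\<^sup>2) * (2 * pi)"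
      using T2 \<eta>'(1) by (intro mult_left_mono) auto
    also have "\<dots> = \<eta>' * (M\<^sup>2 * 2 ^ k * (2 * pi)) * \<epsilon>\<^sup>2" by (simp only: ac_simps)
    also have "\<dots> = \<eta> * \<epsilon>\<^sup>2" by (simp only: \<eta>'(2))
    finally show "\<bar>T - pi + (real k + 2) * integral {0..pi} (angular P) * radius P p ^ k
        - 2 * (real k + 1) * (real k + 2) * integral {0..pi} (\<lambda>\<theta>. (angular P \<theta>)\<^sup>2)
          * (radius P p ^ k)\<^sup>2\<bar> \<le> \<eta> * (radius P p ^ k)\<^sup>2"
      by (simp add: G_def A1 A2 \<epsilon>_def \<rho>_def algebra_simps)
  qed (use r0 in auto)
qed

text \<open>The point reflection z to -z keeps both the orientation and the time, so a lower arc
  from \<open>q < 0\<close> to \<open>p > 0\<close> becomes an upper arc again starting on the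
  positive axis.\<close>

lemma arc_through_rotate:
  assumes hom: "homogeneous_poly d P"
    and arc: "arc_through (perturbed_field P) {(x, y). y < 0} q p T"
  shows "arc_through (perturbed_field (\<lambda>x y. P (- x) (- y))) {(x, y). y > 0} (- q) (- p) T"
proof -
  obtain Px Py where P: "has_partials P Px Py"
    using homogeneous_poly_partials[OF hom] by blast
  have "has_partials (\<lambda>x y. P (- x) (- y)) (\<lambda>x y. - Px (- x) (- y)) (\<lambda>x y. - Py (- x) (- y))"
    unfolding has_partials_def
  proof (intro allI impI)
    fix x y :: "real \<Rightarrow> real" and x' y' t I
    assume "(x has_real_derivative x') (at t within I)" "(y has_real_derivative y') (at t within I)"
    from has_partials_chain[OF P this[THEN DERIV_minus]]
    show "((\<lambda>t. P (- x t) (- y t)) has_real_derivative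
        - Px (- x t) (- y t) * x' + - Py (- x t) (- y t) * y') (at t within I)"
      by simp
  qed
  from perturbed_field_partials[OF this] perturbed_field_partials[OF P]
  have field: "perturbed_field (\<lambda>x y. P (- x) (- y)) (- z) = - perturbed_field P z" for z
    by (cases z) simp
  from arc obtain \<gamma> where \<gamma>: "0 < T" "trajectory_on (perturbed_field P) {0..T} \<gamma>"
    "\<gamma> 0 = (q, 0)" "\<gamma> T = (p, 0)" "\<forall>t\<in>{0<..<T}. \<gamma> t \<in> {(x, y). y < 0}"
    unfolding arc_through_def by blast
  have "trajectory_on (perturbed_field (\<lambda>x y. P (- x) (- y))) {0..T} (\<lambda>t. - \<gamma> t)"
    using \<gamma>(2) unfolding trajectory_on_def field
    by (auto intro: has_vector_derivative_minus)
  with \<gamma> show ?thesis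
    unfolding arc_through_def by (intro conjI exI[of _ "\<lambda>t. - \<gamma> t"]) (auto simp: split_beta)
qed

text \<open>The Wronskian of two solutions of a trace-free linear system is constant. It vanishes at
  the start because both solutions start on the \<open>x\<close>-axis, so they reach the axis simultaneously.\<close>

lemma linear_arc_time_unique:
  assumes hom: "homogeneous_poly 2 P"
    and arcs: "arc_through (perturbed_field P) {(x, y). y > 0} p1 q1 T1"
      "arc_through (perturbed_field P) {(x, y). y > 0} p2 q2 T2"
    and q: "q1 \<noteq> 0" "q2 \<noteq> 0"
  shows "T1 = T2"
proof -
  obtain a where "\<And>x y. P x y = (\<Sum>i\<le>2. a i * x ^ i * y ^ (2 - i))"
    using hom unfolding homogeneous_poly_def by auto
  then have a: "P x y = a 0 * y\<^sup>2 + a 1 * x * y + a 2 * x\<^sup>2" for x y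
    by (simp add: numeral_2_eq_2)
  have "has_partials P (\<lambda>x y. a 1 * y + 2 * a 2 * x) (\<lambda>x y. 2 * a 0 * y + a 1 * x)"
    unfolding has_partials_def a
    by (auto intro!: derivative_eq_intros simp: algebra_simps)
  note field = perturbed_field_partials[OF this]
  have field': "perturbed_field P z = (- (snd z + (2 * a 0 * snd z + a 1 * fst z)),
      fst z + (a 1 * snd z + 2 * a 2 * fst z))" for z
    using field[of "fst z" "snd z"] by simp
  have not_less: "\<not> T < T'"
    if arc: "arc_through (perturbed_field P) {(x, y). y > 0} p q T"
      and arc': "arc_through (perturbed_field P) {(x, y). y > 0} p' q' T'" and "q \<noteq> 0"
    for p q T p' q' T'
  proof
    assume less: "T < T'"
    from arc obtain \<gamma> where \<gamma>: "0 < T" "trajectory_on (perturbed_field P) {0..T} \<gamma>"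
      "\<gamma> 0 = (p, 0)" "\<gamma> T = (q, 0)"
      unfolding arc_through_def by blast
    from arc' obtain \<gamma>' where \<gamma>': "trajectory_on (perturbed_field P) {0..T'} \<gamma>'"
      "\<gamma>' 0 = (p', 0)" "\<gamma>' T' = (q', 0)" "\<forall>t\<in>{0<..<T'}. \<gamma>' t \<in> {(x, y). y > 0}"
      unfolding arc_through_def by blast
    have traj': "trajectory_on (perturbed_field P) {0..T} \<gamma>'"
      unfolding trajectory_on_def
    proof
      fix t assume "t \<in> {0..T}"
      with \<gamma>'(1) less have "(\<gamma>' has_vector_derivative perturbed_field P (\<gamma>' t)) (at t within {0..T'})"
        by (simp add: trajectory_on_def)
      then show "(\<gamma>' has_vector_derivative perturbed_field P (\<gamma>' t)) (at t within {0..T})"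
        by (rule has_vector_derivative_within_subset) (use less in auto)
    qed
    define W where "W t = fst (\<gamma> t) * snd (\<gamma>' t) - fst (\<gamma>' t) * snd (\<gamma> t)" for t
    have "(W has_real_derivative 0) (at t within {0..T})" if "t \<in> {0..T}" for t
      unfolding W_def
      using trajectory_components[OF \<gamma>(2) that] trajectory_components[OF traj' that]
      by (auto intro!: derivative_eq_intros simp: field' algebra_simps)
    then obtain c where c: "\<And>t. t \<in> {0..T} \<Longrightarrow> W t = c"
      using has_field_derivative_zero_constant[of "{0..T}" W] by auto
    have "W T = W 0" using c[of 0] c[of T] \<gamma>(1) by simp
    \<comment> \<open>At time \<open>T\<close> the shorter arc is back on the axis, while the longer
      one is still strictly above it.\<close>
    then have "q * snd (\<gamma>' T) = 0" using \<gamma> \<gamma>'(2) by (simp add: W_def)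
    moreover have "snd (\<gamma>' T) > 0" using bspec[OF \<gamma>'(4), of T] \<gamma>(1) less by (auto simp: split_beta)
    ultimately show False using \<open>q \<noteq> 0\<close> by simp
  qed
  show ?thesis
    using not_less[OF arcs(1,2) q(1)] not_less[OF arcs(2,1) q(2)] by simp
qed

text \<open>The uniform estimate along a family of arcs with arbitrary parameter: the rotated lower
  arcs start at \<open>- q p\<close>, yet must be studied as functions of \<open>p\<close>.\<close>

lemma upper_arc_time_tendsto:
  fixes k :: nat and p q T :: "'a \<Rightarrow> real"
  assumes hom: "homogeneous_poly (k + 2) P" and k: "1 \<le> k"
    and p: "(p \<longlongrightarrow> 0) F"
    and arcs: "\<forall>\<^sub>F s in F. 0 < p s \<and> q s < 0 \<and>
      arc_through (perturbed_field P) {(x, y). y > 0} (p s) (q s) (T s)"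
  shows "((\<lambda>s. (T s - pi + (real k + 2) * integral {0..pi} (angular P) * radius P (p s) ^ k
        - 2 * (real k + 1) * (real k + 2) * integral {0..pi} (\<lambda>\<theta>. (angular P \<theta>)\<^sup>2)
          * (radius P (p s) ^ k)\<^sup>2) / (radius P (p s) ^ k)\<^sup>2) \<longlongrightarrow> 0) F" (is "((\<lambda>s. ?N s / ?D s) \<longlongrightarrow> 0) F")
    and "\<forall>\<^sub>F s in F. energy P (q s) 0 = energy P (p s) 0 \<and> (q s)\<^sup>2 \<le> 4 * (p s)\<^sup>2"
proof -
  have *: "\<forall>\<^sub>F s in F. \<bar>?N s\<bar> \<le> \<eta> * ?D s \<and> energy P (q s) 0 = energy P (p s) 0 \<and> (q s)\<^sup>2 \<le> 4 * (p s)\<^sup>2"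
    if \<eta>: "\<eta> > 0" for \<eta>
  proof -
    obtain \<delta> where \<delta>: "\<delta> > 0" and *: "\<And>p q T. 0 < p \<Longrightarrow> p < \<delta> \<Longrightarrow> q < 0 \<Longrightarrow>
      arc_through (perturbed_field P) {(x, y). y > 0} p q T \<Longrightarrow>
      \<bar>T - pi + (real k + 2) * integral {0..pi} (angular P) * radius P p ^ k
        - 2 * (real k + 1) * (real k + 2) * integral {0..pi} (\<lambda>\<theta>. (angular P \<theta>)\<^sup>2)
          * (radius P p ^ k)\<^sup>2\<bar> \<le> \<eta> * (radius P p ^ k)\<^sup>2
      \<and> energy P q 0 = energy P p 0 \<and> q\<^sup>2 \<le> 4 * p\<^sup>2"
      using upper_arc_time[OF hom k \<eta>] by blast
    have "\<forall>\<^sub>F s in F. p s < \<delta>" using order_tendstoD(2)[OF p \<delta>] .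
    with arcs show ?thesis by eventually_elim (use * in blast)
  qed
  show "((\<lambda>s. ?N s / ?D s) \<longlongrightarrow> 0) F"
  proof (rule tendstoI)
    fix \<eta> :: real assume "\<eta> > 0"
    then have "\<eta> / 2 > 0" by simp
    from *[OF this] show "\<forall>\<^sub>F s in F. dist (?N s / ?D s) 0 < \<eta>"
    proof eventually_elim
      case (elim s)
      have "\<bar>?N s\<bar> / ?D s \<le> \<eta> / 2"
        using elim \<open>\<eta> > 0\<close> by (cases "?D s = 0") (simp_all add: divide_le_eq)
      moreover have "dist (n / d\<^sup>2) 0 = \<bar>n\<bar> / d\<^sup>2" for n d :: real by simp
      ultimately show ?case using \<open>\<eta> > 0\<close> by (simp only:)
    qed
  qed
  show "\<forall>\<^sub>F s in F. energy P (q s) 0 = energy P (p s) 0 \<and> (q s)\<^sup>2 \<le> 4 * (p s)\<^sup>2"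
    using *[of 1] by (auto elim: eventually_mono)
qed

text \<open>On the x-axis the energy is exactly p^2 (1 + 2 P(1,0) p^k). Thus both arc times become
  expansions in powers of the same \<open>p\<close>.\<close>

lemma radius_asymp:
  fixes k :: nat
  assumes hom: "homogeneous_poly (k + 2) P" and k: "1 \<le> k"
  shows "((\<lambda>p. radius P p ^ j / p ^ j) \<longlongrightarrow> 1) (at_right 0)"
proof -
  have "((\<lambda>p. sqrt (1 + 2 * P 1 0 * p ^ k) ^ j) \<longlongrightarrow> sqrt (1 + 2 * P 1 0 * 0 ^ k) ^ j) (at_right (0::real))"
    by (intro tendsto_intros)
  also have "sqrt (1 + 2 * P 1 0 * 0 ^ k) ^ j = 1" using k by (simp add: power_0_left)
  finally show ?thesis
  proof (rule Lim_transform_eventually)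
    show "\<forall>\<^sub>F p in at_right 0. sqrt (1 + 2 * P 1 0 * p ^ k) ^ j = radius P p ^ j / p ^ j"
      using eventually_at_right_less
    proof eventually_elim
      case (elim p)
      have "energy P p 0 = p\<^sup>2 * (1 + 2 * P 1 0 * p ^ k)"
        using homogeneous_poly_scale[OF hom, of p 1 0]
        by (simp add: energy_def power_add algebra_simps power2_eq_square)
      then have "radius P p = p * sqrt (1 + 2 * P 1 0 * p ^ k)"
        using elim by (simp add: radius_def real_sqrt_mult)
      then show ?case using elim by (simp add: power_mult_distrib)
    qed
  qed
qed

section \<open>Comparison of asymptotic expansions\<close>

text \<open>Passing to the limit, then dividing by \<open>e s\<close>, then by its square, kills
  \<open>a\<close>, \<open>b\<close> and \<open>c\<close> in turn.\<close>

lemma quadratic_expansion_zero: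
  fixes e r :: "'a \<Rightarrow> real"
  assumes F: "F \<noteq> bot" and e: "(e \<longlongrightarrow> 0) F" "\<forall>\<^sub>F s in F. e s \<noteq> 0"
    and r: "(r \<longlongrightarrow> 0) F" "\<forall>\<^sub>F s in F. a + b * e s - c * (e s)\<^sup>2 = r s * (e s)\<^sup>2"
  shows "c = 0"
proof -
  have "((\<lambda>s. r s * (e s)\<^sup>2 - b * e s + c * (e s)\<^sup>2) \<longlongrightarrow> 0 * 0\<^sup>2 - b * 0 + c * 0\<^sup>2) F"
    by (intro tendsto_intros e r)
  moreover have "\<forall>\<^sub>F s in F. r s * (e s)\<^sup>2 - b * e s + c * (e s)\<^sup>2 = a"
    using r(2) by eventually_elim simp
  ultimately have "((\<lambda>s. a) \<longlongrightarrow> 0) F" by (simp add: tendsto_cong)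
  then have a: "a = 0" using F by (simp add: tendsto_const_iff)
  have "((\<lambda>s. r s * e s + c * e s) \<longlongrightarrow> 0 * 0 + c * 0) F"
    by (intro tendsto_intros e r)
  moreover have "\<forall>\<^sub>F s in F. r s * e s + c * e s = b"
    using r(2) e(2)
  proof eventually_elim
    case (elim s)
    then have "e s * (r s * e s + c * e s) = e s * b" by (simp add: a algebra_simps power2_eq_square)
    then show ?case using elim(2) by (subst (asm) mult_left_cancel) auto
  qed
  ultimately have "((\<lambda>s. b) \<longlongrightarrow> 0) F" by (simp add: tendsto_cong)
  then have b: "b = 0" using F by (simp add: tendsto_const_iff)
  have "\<forall>\<^sub>F s in F. r s = - c"
    using r(2) e(2)
  proof eventually_elim
    case (elim s)
    then have "(e s)\<^sup>2 * r s = (e s)\<^sup>2 * - c" by (simp add: a b mult.commute)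
    then show ?case using elim(2) by (subst (asm) mult_left_cancel) auto
  qed
  with r(1) have "((\<lambda>s. - c) \<longlongrightarrow> 0) F" by (simp add: tendsto_cong)
  then show ?thesis using F by (simp add: tendsto_const_iff)
qed

text \<open>The terms have orders i, 2i, j and 2j in \<open>s\<close>. Order i is the lowest, so
  \<open>d\<close> and \<open>a\<close> vanish first; order 2i then differs from j by hypothesis and
  from 2j because i < j, so nothing can compensate \<open>b\<close>.\<close>

lemma two_scale_expansion_zero:
  fixes u v r r' :: "real \<Rightarrow> real" and i j :: nat
  assumes ij: "1 \<le> i" "i < j" "j \<noteq> 2 * i"
    and u: "(u \<longlongrightarrow> 1) (at_right 0)" and v: "(v \<longlongrightarrow> 1) (at_right 0)"
    and r: "(r \<longlongrightarrow> 0) (at_right 0)" and r': "(r' \<longlongrightarrow> 0) (at_right 0)"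
    and eq: "\<forall>\<^sub>F s in at_right 0. d + a * (u s * s ^ i) - b * (u s * s ^ i)\<^sup>2
        + a' * (v s * s ^ j) - b' * (v s * s ^ j)\<^sup>2
      = r s * (u s * s ^ i)\<^sup>2 + r' s * (v s * s ^ j)\<^sup>2"
  shows "b = 0"
proof -
  have const: "c = 0" if "(f \<longlongrightarrow> 0) (at_right 0)" "\<forall>\<^sub>F s in at_right 0. f s = c"
    for f :: "real \<Rightarrow> real" and c
    using that by (simp add: tendsto_cong tendsto_const_iff)
  have pow: "((\<lambda>s::real. s ^ l) \<longlongrightarrow> 0) (at_right 0)" if "l > 0" for l
    using that by (auto intro!: tendsto_eq_intros)
  note lims = tendsto_eq_intros u v r r' pow
  have d: "d = 0"
    by (rule const[of "\<lambda>s. r s * (u s * s ^ i)\<^sup>2 + r' s * (v s * s ^ j)\<^sup>2 - a * (u s * s ^ i)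
        + b * (u s * s ^ i)\<^sup>2 - a' * (v s * s ^ j) + b' * (v s * s ^ j)\<^sup>2"])
      (use ij eq in \<open>auto intro!: lims simp: power_0_left elim: eventually_mono\<close>)
  \<comment> \<open>Dividing by \<open>s ^ i\<close> and writing \<open>u s\<close> as 1 plus
    \<open>u s - 1\<close> leaves \<open>- a\<close> equal to a function tending to 0. The other
    coefficients are isolated in the same way.\<close>
  have a: "- a = 0"
  proof (rule const[of "\<lambda>s. a * (u s - 1) - (b + r s) * (u s)\<^sup>2 * s ^ i + a' * v s * s ^ (j - i)
      - (b' + r' s) * (v s)\<^sup>2 * s ^ (2 * j - i)"])
    show "\<forall>\<^sub>F s in at_right 0. a * (u s - 1) - (b + r s) * (u s)\<^sup>2 * s ^ i + a' * v s * s ^ (j - i)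
      - (b' + r' s) * (v s)\<^sup>2 * s ^ (2 * j - i) = - a"
      using eq eventually_at_right_less
    proof eventually_elim
      case (elim s)
      have "s ^ j = s ^ i * s ^ (j - i)" "(s ^ j)\<^sup>2 = s ^ i * s ^ (2 * j - i)"
        using ij by (simp_all flip: power_add power_mult add: mult.commute)
      with elim(1) have "s ^ i * (a * (u s - 1) - (b + r s) * (u s)\<^sup>2 * s ^ i + a' * v s * s ^ (j - i)
          - (b' + r' s) * (v s)\<^sup>2 * s ^ (2 * j - i)) = s ^ i * - a"
        by (simp add: d power_mult_distrib) (simp add: algebra_simps power2_eq_square)
      then show ?case using elim(2) by (subst (asm) mult_left_cancel) auto
    qed
  qed (use ij in \<open>auto intro!: lims simp: power_0_left\<close>)
  \<comment> \<open>Ring identities with \<open>A\<close>, \<open>B\<close> for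
    \<open>s ^ i\<close>, \<open>s ^ j\<close> and \<open>C\<close>, \<open>D\<close> for quotients
    of powers. The first premise carries the factor \<open>a'\<close> so that it also holds for
    \<open>a' = 0\<close>, where the exponent \<open>j - 2 * i\<close> may be truncated.\<close>
  have cancel_small: "A\<^sup>2 * (b * (1 - U\<^sup>2) - R * U\<^sup>2 + a' * V * C - (b' + R') * V\<^sup>2 * D) = A\<^sup>2 * b"
    if "a' * B = a' * A\<^sup>2 * C" "B\<^sup>2 = A\<^sup>2 * D"
      "- b * (U * A)\<^sup>2 + a' * (V * B) - b' * (V * B)\<^sup>2 = R * (U * A)\<^sup>2 + R' * (V * B)\<^sup>2"
    for A B C D U V R R' a' b b' :: real
    using that by algebra
  have cancel_large: "B * (a' * (V - 1) - (b + R) * U\<^sup>2 * C - (b' + R') * V\<^sup>2 * B) = B * - a'"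
    if "A\<^sup>2 = B * C"
      "- b * (U * A)\<^sup>2 + a' * (V * B) - b' * (V * B)\<^sup>2 = R * (U * A)\<^sup>2 + R' * (V * B)\<^sup>2"
    for A B C U V R R' a' b b' :: real
    using that by algebra
  have final: "b = 0" if small: "a' = 0 \<or> 2 * i < j"
  proof (rule const[of "\<lambda>s. b * (1 - (u s)\<^sup>2) - r s * (u s)\<^sup>2 + a' * v s * s ^ (j - 2 * i)
      - (b' + r' s) * (v s)\<^sup>2 * s ^ (2 * j - 2 * i)"])
    show "\<forall>\<^sub>F s in at_right 0. b * (1 - (u s)\<^sup>2) - r s * (u s)\<^sup>2 + a' * v s * s ^ (j - 2 * i)
      - (b' + r' s) * (v s)\<^sup>2 * s ^ (2 * j - 2 * i) = b"
      using eq eventually_at_right_less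
    proof eventually_elim
      case (elim s)
      have "a' * s ^ j = a' * (s ^ i)\<^sup>2 * s ^ (j - 2 * i)"
        using small by (auto simp flip: power_add power_mult simp: mult.commute)
      moreover have "(s ^ j)\<^sup>2 = (s ^ i)\<^sup>2 * s ^ (2 * j - 2 * i)"
        using ij by (simp flip: power_add power_mult add: mult.commute)
      moreover have "- b * (u s * s ^ i)\<^sup>2 + a' * (v s * s ^ j) - b' * (v s * s ^ j)\<^sup>2
          = r s * (u s * s ^ i)\<^sup>2 + r' s * (v s * s ^ j)\<^sup>2"
        using elim(1) a d by simp
      ultimately have "(s ^ i)\<^sup>2 * (b * (1 - (u s)\<^sup>2) - r s * (u s)\<^sup>2 + a' * v s * s ^ (j - 2 * i)
          - (b' + r' s) * (v s)\<^sup>2 * s ^ (2 * j - 2 * i)) = (s ^ i)\<^sup>2 * b"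
        by (rule cancel_small)
      then show ?case using elim(2) by (subst (asm) mult_left_cancel) auto
    qed
    show "((\<lambda>s. b * (1 - (u s)\<^sup>2) - r s * (u s)\<^sup>2 + a' * v s * s ^ (j - 2 * i)
      - (b' + r' s) * (v s)\<^sup>2 * s ^ (2 * j - 2 * i)) \<longlongrightarrow> 0) (at_right 0)"
      using small ij by (auto intro!: lims simp: power_0_left)
  qed
  show ?thesis
  proof (cases "2 * i < j")
    case False
    \<comment> \<open>Now \<open>a'\<close> belongs to a lower order than \<open>b\<close> and has
      to be eliminated first.\<close>
    with ij have less: "j < 2 * i" by simp
    have "- a' = 0"
    proof (rule const[of "\<lambda>s. a' * (v s - 1) - (b + r s) * (u s)\<^sup>2 * s ^ (2 * i - j)
        - (b' + r' s) * (v s)\<^sup>2 * s ^ j"])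
      show "\<forall>\<^sub>F s in at_right 0. a' * (v s - 1) - (b + r s) * (u s)\<^sup>2 * s ^ (2 * i - j)
          - (b' + r' s) * (v s)\<^sup>2 * s ^ j = - a'"
        using eq eventually_at_right_less
      proof eventually_elim
        case (elim s)
        have "(s ^ i)\<^sup>2 = s ^ j * s ^ (2 * i - j)"
          using less by (simp flip: power_add power_mult add: mult.commute)
        moreover have "- b * (u s * s ^ i)\<^sup>2 + a' * (v s * s ^ j) - b' * (v s * s ^ j)\<^sup>2
            = r s * (u s * s ^ i)\<^sup>2 + r' s * (v s * s ^ j)\<^sup>2"
          using elim(1) a d by simp
        ultimately have "s ^ j * (a' * (v s - 1) - (b + r s) * (u s)\<^sup>2 * s ^ (2 * i - j)
            - (b' + r' s) * (v s)\<^sup>2 * s ^ j) = s ^ j * - a'"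
          by (rule cancel_large)
        then show ?case using elim(2) by (subst (asm) mult_left_cancel) auto
      qed
    qed (use ij less in \<open>auto intro!: lims simp: power_0_left\<close>)
    then show ?thesis using final by simp
  qed (use final in simp)
qed

section \<open>Comparison of the upper and lower arc times for even \<open>n\<close>\<close>

theorem proposition2:
  fixes n m :: nat
    and P Q Hp Hm :: "real \<Rightarrow> real \<Rightarrow> real"
    and Xp Xm :: "real \<times> real \<Rightarrow> real \<times> real"
  assumes "1 \<le> m" and "m \<le> n"
    and "homogeneous_poly (n + 1) P"
    and "homogeneous_poly (m + 1) Q"
    and "Hp = (\<lambda>x y. (x\<^sup>2 + y\<^sup>2) / 2 + P x y)"
    and "Hm = (\<lambda>x y. (x\<^sup>2 + y\<^sup>2) / 2 + Q x y)"
    and "Xp = hamiltonian_field Hp"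
    and "Xm = hamiltonian_field Hm"
    and "even n"
  shows "\<not> isochronous_sigma_center Xp Xm"
proof
  assume iso: "isochronous_sigma_center Xp Xm"
  have X: "Xp = perturbed_field P" "Xm = perturbed_field Q"
    using assms(5-8) by (simp_all add: perturbed_field_def)
  obtain j where "n = j + 1"
    using assms(1,2) by (cases n) auto
  with assms(9) have j: "n = j + 1" "1 \<le> j" "odd j"
    using odd_pos[of j] by auto
  have homP: "homogeneous_poly (j + 2) P" using assms(3) j by simp
  define Q' where "Q' = (\<lambda>x y. Q (- x) (- y))"
  have homQ': "homogeneous_poly (m + 1) Q'"
    unfolding Q'_def by (rule homogeneous_poly_rotate[OF assms(4)])
  from iso obtain T0 where "\<forall>\<^sub>F p in at_right 0. \<exists>T. closed_orbit_period Xp Xm p T"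
    "\<forall>\<^sub>F p in at_right 0. \<forall>T. closed_orbit_period Xp Xm p T \<longrightarrow> T = T0"
    unfolding isochronous_sigma_center_def sigma_center_def by blast
  \<comment> \<open>Bundling the endpoint and both times into one triple lets a single choice make
    them functions of \<open>p\<close>.\<close>
  then have "\<forall>\<^sub>F p in at_right 0. \<exists>z. fst z < 0 \<and>
      arc_through Xp {(x, y). y > 0} p (fst z) (fst (snd z)) \<and>
      arc_through Xm {(x, y). y < 0} (fst z) p (snd (snd z)) \<and> fst (snd z) + snd (snd z) = T0"
    by eventually_elim (fastforce simp: closed_orbit_period_def)
  then obtain z where z: "\<forall>\<^sub>F p in at_right 0. fst (z p) < 0 \<and>
      arc_through Xp {(x, y). y > 0} p (fst (z p)) (fst (snd (z p))) \<and>
      arc_through Xm {(x, y). y < 0} (fst (z p)) p (snd (snd (z p))) \<and>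
      fst (snd (z p)) + snd (snd (z p)) = T0"
    unfolding eventually_ex by blast
  define q where "q p = fst (z p)" for p
  define Tp where "Tp p = fst (snd (z p))" for p
  define Tm where "Tm p = snd (snd (z p))" for p
  have orbit: "\<forall>\<^sub>F p in at_right 0. 0 < p \<and> q p < 0 \<and>
      arc_through (perturbed_field P) {(x, y). y > 0} p (q p) (Tp p) \<and>
      arc_through (perturbed_field Q') {(x, y). y > 0} (- q p) (- p) (Tm p) \<and> Tp p + Tm p = T0"
    using z eventually_at_right_less
    by eventually_elim (auto simp: q_def Tp_def Tm_def X Q'_def intro: arc_through_rotate[OF assms(4)])
  define \<beta> where "\<beta> p = radius P p ^ j" for p
  define b1 where "b1 = (real j + 2) * integral {0..pi} (angular P)"
  define b2 where "b2 = 2 * (real j + 1) * (real j + 2) * integral {0..pi} (\<lambda>\<theta>. (angular P \<theta>)\<^sup>2)"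
  define rp where "rp p = (Tp p - pi + b1 * \<beta> p - b2 * (\<beta> p)\<^sup>2) / (\<beta> p)\<^sup>2" for p
  have b2: "b2 > 0"
    using integral_angular_square_pos[OF homP] by (simp add: b2_def)
  have ident: "((\<lambda>p. p) \<longlongrightarrow> 0) (at_right (0::real))" by (rule tendsto_ident_at)
  have upper: "\<forall>\<^sub>F p in at_right 0. 0 < p \<and> q p < 0 \<and>
      arc_through (perturbed_field P) {(x, y). y > 0} p (q p) (Tp p)"
    using orbit by (auto elim: eventually_mono)
  have rp: "(rp \<longlongrightarrow> 0) (at_right 0)"
    using upper_arc_time_tendsto(1)[OF homP j(2) ident upper]
    by (simp add: rp_def[abs_def] b1_def b2_def \<beta>_def)
  have q: "\<forall>\<^sub>F p in at_right 0. energy P (q p) 0 = energy P p 0 \<and> (q p)\<^sup>2 \<le> 4 * p\<^sup>2"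
    by (rule upper_arc_time_tendsto(2)[OF homP j(2) ident upper])
  have \<beta>_asymp: "((\<lambda>p. \<beta> p / p ^ j) \<longlongrightarrow> 1) (at_right 0)"
    unfolding \<beta>_def by (rule radius_asymp[OF homP j(2)])
  have ne: "\<forall>\<^sub>F p in at_right 0. e p \<noteq> 0" and lim: "(e \<longlongrightarrow> 0) (at_right 0)"
    if "((\<lambda>p. e p / p ^ l) \<longlongrightarrow> 1) (at_right (0::real))" "1 \<le> l" for e :: "real \<Rightarrow> real" and l
  proof -
    have "\<forall>\<^sub>F p in at_right 0. 0 < e p / p ^ l"
      using order_tendstoD(1)[OF that(1), of 0] by simp
    then show "\<forall>\<^sub>F p in at_right 0. e p \<noteq> 0" by (auto elim: eventually_mono)
    have "((\<lambda>p. e p / p ^ l * p ^ l) \<longlongrightarrow> 1 * 0 ^ l) (at_right 0)"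
      by (intro tendsto_intros that)
    then have "((\<lambda>p. e p / p ^ l * p ^ l) \<longlongrightarrow> 0) (at_right 0)"
      using that(2) by (simp add: power_0_left)
    then show "(e \<longlongrightarrow> 0) (at_right 0)"
    proof (rule Lim_transform_eventually)
      show "\<forall>\<^sub>F p in at_right 0. e p / p ^ l * p ^ l = e p"
        using eventually_at_right_less by eventually_elim simp
    qed
  qed
  have rp_eq: "\<forall>\<^sub>F p in at_right 0. Tp p - pi + b1 * \<beta> p - b2 * (\<beta> p)\<^sup>2 = rp p * (\<beta> p)\<^sup>2"
    using ne[OF \<beta>_asymp j(2)] by eventually_elim (simp add: rp_def)
  show False
  proof (cases "m = 1")
    case True
    with homQ' have homQ2: "homogeneous_poly 2 Q'" by (simp add: numeral_2_eq_2)
    obtain p0 where p0: "p0 > 0" "arc_through (perturbed_field Q') {(x, y). y > 0} (- q p0) (- p0) (Tm p0)"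
      using eventually_happens'[OF _ orbit] by auto
    \<comment> \<open>For \<open>m = 1\<close> all lower arcs take the time \<open>Tm p0\<close>, so
      the upper expansion alone must be constant.\<close>
    have "\<forall>\<^sub>F p in at_right 0. T0 - Tm p0 - pi + b1 * \<beta> p - b2 * (\<beta> p)\<^sup>2 = rp p * (\<beta> p)\<^sup>2"
      using orbit rp_eq
    proof eventually_elim
      case (elim p)
      then have "Tm p = Tm p0"
        using linear_arc_time_unique[OF homQ2 _ p0(2)] p0(1) by force
      with elim show ?case by simp
    qed
    with quadratic_expansion_zero[OF _ lim[OF \<beta>_asymp j(2)] ne[OF \<beta>_asymp j(2)] rp] b2
    show False by auto
  next
    case False
    then obtain i where i: "m = i + 1" "1 \<le> i" using assms(1) by (cases m) auto
    have homQ: "homogeneous_poly (i + 2) Q" using assms(4) i by simp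
    have homQ'': "homogeneous_poly (i + 2) Q'" using homQ' i by simp
    \<comment> \<open>The rotated arc starts at \<open>- q p\<close>, but energy conservation gives
      the same radius at \<open>p\<close>.\<close>
    define \<alpha> where "\<alpha> p = radius Q p ^ i" for p
    define a1 where "a1 = (real i + 2) * integral {0..pi} (angular Q')"
    define a2 where "a2 = 2 * (real i + 1) * (real i + 2) * integral {0..pi} (\<lambda>\<theta>. (angular Q' \<theta>)\<^sup>2)"
    define rm where "rm p = (Tm p - pi + a1 * \<alpha> p - a2 * (\<alpha> p)\<^sup>2) / (\<alpha> p)\<^sup>2" for p
    have a2: "a2 > 0"
      using integral_angular_square_pos[OF homQ'] by (simp add: a2_def)
    have q_lim: "((\<lambda>p. - q p) \<longlongrightarrow> 0) (at_right 0)"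
    proof (rule Lim_null_comparison)
      show "\<forall>\<^sub>F p in at_right 0. norm (- q p) \<le> 2 * p"
        using q orbit
      proof eventually_elim
        case (elim p)
        then have "(q p)\<^sup>2 \<le> (2 * p)\<^sup>2" by (simp add: power_mult_distrib)
        then have "\<bar>q p\<bar> \<le> \<bar>2 * p\<bar>" by (simp only: abs_le_square_iff)
        with elim show ?case by simp
      qed
      show "((\<lambda>p. 2 * p) \<longlongrightarrow> 0) (at_right (0::real))" by (auto intro!: tendsto_eq_intros)
    qed
    have lower: "\<forall>\<^sub>F p in at_right 0. 0 < - q p \<and> - p < 0 \<and>
        arc_through (perturbed_field Q') {(x, y). y > 0} (- q p) (- p) (Tm p)"
      using orbit by (auto elim: eventually_mono)
    have energy_Q': "energy Q' (- x) 0 = energy Q x 0" for x by (simp add: energy_def Q'_def)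
    have q': "\<forall>\<^sub>F p in at_right 0. energy Q (q p) 0 = energy Q p 0"
      using upper_arc_time_tendsto(2)[OF homQ'' i(2) q_lim lower]
      by (auto simp: energy_Q' elim: eventually_mono)
    have rm: "(rm \<longlongrightarrow> 0) (at_right 0)"
    proof (rule Lim_transform_eventually)
      show "((\<lambda>p. (Tm p - pi + a1 * radius Q' (- q p) ^ i - a2 * (radius Q' (- q p) ^ i)\<^sup>2)
          / (radius Q' (- q p) ^ i)\<^sup>2) \<longlongrightarrow> 0) (at_right 0)"
        using upper_arc_time_tendsto(1)[OF homQ'' i(2) q_lim lower] by (simp add: a1_def a2_def)
      show "\<forall>\<^sub>F p in at_right 0. (Tm p - pi + a1 * radius Q' (- q p) ^ i
          - a2 * (radius Q' (- q p) ^ i)\<^sup>2) / (radius Q' (- q p) ^ i)\<^sup>2 = rm p"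
        using q' by eventually_elim (simp add: radius_def energy_Q' rm_def \<alpha>_def)
    qed
    have \<alpha>_asymp: "((\<lambda>p. \<alpha> p / p ^ i) \<longlongrightarrow> 1) (at_right 0)"
      unfolding \<alpha>_def by (rule radius_asymp[OF homQ i(2)])
    have rm_eq: "\<forall>\<^sub>F p in at_right 0. Tm p - pi + a1 * \<alpha> p - a2 * (\<alpha> p)\<^sup>2 = rm p * (\<alpha> p)\<^sup>2"
      using ne[OF \<alpha>_asymp i(2)] by eventually_elim (simp add: rm_def)
    show False
    proof (cases "i = j")
      case True
      \<comment> \<open>Subtracting the two energy relations between \<open>q p\<close> and
        \<open>p\<close> cancels the quadratic terms. As \<open>j + 2 = n + 1\<close> is odd,
        \<open>q p ^ (j + 2)\<close> is negative and cannot equal \<open>p ^ (j + 2)\<close>, so the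
        leading coefficients agree.\<close>
      have "\<forall>\<^sub>F p in at_right (0::real). P 1 0 = Q 1 0"
        using q q' orbit
      proof eventually_elim
        case (elim p)
        have pow: "P x 0 = x ^ (j + 2) * P 1 0" "Q x 0 = x ^ (j + 2) * Q 1 0" for x
          using homogeneous_poly_scale[OF homP, of x 1 0] homogeneous_poly_scale[OF homQ, of x 1 0] True
          by simp_all
        have "P (q p) 0 - P p 0 = Q (q p) 0 - Q p 0"
          using elim by (simp add: energy_def)
        then have "(q p ^ (j + 2) - p ^ (j + 2)) * (P 1 0 - Q 1 0) = 0"
          by (simp only: pow[of "q p"] pow[of p]) (simp only: algebra_simps)
        moreover have "q p ^ (j + 2) < 0" "p ^ (j + 2) > 0"
          using elim j(3) by (simp_all only: power_less_zero_eq zero_less_power) simp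
        ultimately show ?case by auto
      qed
      then have "P 1 0 = Q 1 0" by simp
      then have "P p 0 = Q p 0" for p
        using homogeneous_poly_scale[OF homP, of p 1 0] homogeneous_poly_scale[OF homQ, of p 1 0] True
        by simp
      then have "\<alpha> = \<beta>" by (simp add: \<alpha>_def \<beta>_def True radius_def energy_def fun_eq_iff)
      have "\<forall>\<^sub>F p in at_right 0. (T0 - 2 * pi) + (a1 + b1) * \<beta> p - (a2 + b2) * (\<beta> p)\<^sup>2
          = (rm p + rp p) * (\<beta> p)\<^sup>2"
        using rm_eq rp_eq orbit
        by eventually_elim (simp add: \<open>\<alpha> = \<beta>\<close> algebra_simps)
      moreover have "((\<lambda>p. rm p + rp p) \<longlongrightarrow> 0) (at_right 0)"
        using tendsto_add[OF rm rp] by simp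
      ultimately have "a2 + b2 = 0"
        by (intro quadratic_expansion_zero[OF _ lim[OF \<beta>_asymp j(2)] ne[OF \<beta>_asymp j(2)]]) auto
      with a2 b2 show False by simp
    next
      case False
      with i j assms(2) have "i < j" by simp
      \<comment> \<open>Evenness of \<open>n\<close> enters here: an odd \<open>j\<close> excludes
        the resonance of the two scales.\<close>
      moreover have "j \<noteq> 2 * i" using j(3) by auto
      moreover have "\<forall>\<^sub>F p in at_right 0. (T0 - 2 * pi) + a1 * (\<alpha> p / p ^ i * p ^ i)
          - a2 * (\<alpha> p / p ^ i * p ^ i)\<^sup>2 + b1 * (\<beta> p / p ^ j * p ^ j) - b2 * (\<beta> p / p ^ j * p ^ j)\<^sup>2
          = rm p * (\<alpha> p / p ^ i * p ^ i)\<^sup>2 + rp p * (\<beta> p / p ^ j * p ^ j)\<^sup>2"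
        using rm_eq rp_eq orbit
      proof eventually_elim
        case (elim p)
        then have "\<alpha> p / p ^ i * p ^ i = \<alpha> p" "\<beta> p / p ^ j * p ^ j = \<beta> p" by auto
        with elim show ?case by (simp only:) linarith
      qed
      ultimately have "a2 = 0"
        by (rule two_scale_expansion_zero[OF i(2) _ _ \<alpha>_asymp \<beta>_asymp rm rp])
      with a2 show False by simp
    qed
  qed
qed

end
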